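(* Let $k\ge3$ and let $V\subset\mathbb{C}^k$ be an algebraic variety of codimension $2$. Then there exist a Short $\mathbb{C}^k$ $\Omega$ and a Fatou–Bieberbach domain $D$ such that $D\subset\Omega\subset\mathbb{C}^k\setminus V$.
   Context: A Short $\mathbb{C}^k$ is a domain $\Omega\subset\mathbb{C}^k$ such that: (1) $\Omega=\bigcup_{j\ge1}\Omega_j$ with $\Omega_j\subset\Omega_{j+1}$ and each $\Omega_j$ biholomorphic to the unit ball of $\mathbb{C}^k$; (2) the infinitesimal Kobayashi pseudometric of $\Omega$ vanishes identically; (3) $\Omega$ carries a non-constant plurisubharmonic function that is bounded above. A Fatou–Bieberbach domain is a proper subdomain of $\mathbb{C}^k$ that is biholomorphic to $\mathbb{C}^k$. *)

theory Defs
  imports "HOL-Analysis.Analysis"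
begin

inductive_set cpoly :: "(complex^'n \<Rightarrow> complex) set" where
  const: "(\<lambda>x. c) \<in> cpoly"
| coord: "(\<lambda>x. x $ i) \<in> cpoly"
| add: "p \<in> cpoly \<Longrightarrow> q \<in> cpoly \<Longrightarrow> (\<lambda>x. p x + q x) \<in> cpoly"
| mult: "p \<in> cpoly \<Longrightarrow> q \<in> cpoly \<Longrightarrow> (\<lambda>x. p x * q x) \<in> cpoly"

definition algebraic_set :: "(complex^'n) set \<Rightarrow> bool" where
  "algebraic_set V \<longleftrightarrow>
     (\<exists>P. finite P \<and> P \<subseteq> cpoly \<and> V = {x. \<forall>p\<in>P. p x = 0})"

definition coords_indep_on :: "'n set \<Rightarrow> (complex^'n) set \<Rightarrow> bool" where
  "coords_indep_on S V \<longleftrightarrow>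
     (\<forall>p\<in>cpoly. (\<forall>x y. (\<forall>i\<in>S. x $ i = y $ i) \<longrightarrow> p x = p y)
        \<longrightarrow> (\<forall>x\<in>V. p x = 0) \<longrightarrow> (\<forall>x. p x = 0))"

text \<open>Dimension of an algebraic set (transcendence degree of its coordinate ring).\<close>
definition has_alg_dim :: "(complex^'n) set \<Rightarrow> nat \<Rightarrow> bool" where
  "has_alg_dim V d \<longleftrightarrow>
     (\<exists>S. coords_indep_on S V \<and> card S = d) \<and>
     (\<forall>S. coords_indep_on S V \<longrightarrow> card S \<le> d)"

definition holo_map :: "(complex^'n) set \<Rightarrow> (complex^'n \<Rightarrow> complex^'m) \<Rightarrow> bool" where
  "holo_map U f \<longleftrightarrow>
     (\<forall>x\<in>U. \<exists>L. (f has_derivative L) (at x) \<and> (\<forall>c v. L (c *s v) = c *s L v))"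

definition biholomorphic :: "(complex^'n) set \<Rightarrow> (complex^'n) set \<Rightarrow> bool" where
  "biholomorphic A B \<longleftrightarrow> open A \<and> open B \<and>
     (\<exists>f g. holo_map A f \<and> holo_map B g \<and> f ` A = B \<and> g ` B = A \<and>
            (\<forall>x\<in>A. g (f x) = x) \<and> (\<forall>y\<in>B. f (g y) = y))"

definition holo_disc :: "(complex \<Rightarrow> complex^'n) \<Rightarrow> bool" where
  "holo_disc \<phi> \<longleftrightarrow> (\<forall>z\<in>ball 0 1. \<exists>w. (\<phi> has_derivative (\<lambda>h. h *s w)) (at z))"

definition kobayashi :: "(complex^'n) set \<Rightarrow> complex^'n \<Rightarrow> complex^'n \<Rightarrow> real" where
  "kobayashi \<Omega> p v = Inf {1 / r | r \<phi>. r > 0 \<and> holo_disc \<phi> \<and> \<phi> ` ball 0 1 \<subseteq> \<Omega> \<and>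
        \<phi> 0 = p \<and> (\<phi> has_derivative (\<lambda>h. h *s (r *\<^sub>R v))) (at 0)}"

definition harmonic_on :: "complex set \<Rightarrow> (complex \<Rightarrow> real) \<Rightarrow> bool" where
  "harmonic_on U h \<longleftrightarrow>
     (\<forall>z\<in>U. \<exists>r>0. \<exists>g. g holomorphic_on ball z r \<and> (\<forall>w\<in>ball z r. h w = Re (g w)))"

definition usc_on :: "'a::topological_space set \<Rightarrow> ('a \<Rightarrow> ereal) \<Rightarrow> bool" where
  "usc_on U u \<longleftrightarrow> (\<forall>c::real. openin (top_of_set U) {x\<in>U. u x < ereal c})"

definition subharmonic_on :: "complex set \<Rightarrow> (complex \<Rightarrow> ereal) \<Rightarrow> bool" where
  "subharmonic_on U u \<longleftrightarrow> usc_on U u \<and> (\<forall>z\<in>U. u z < \<infinity>) \<and>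
     (\<forall>K h. compact K \<longrightarrow> K \<subseteq> U \<longrightarrow> continuous_on K h \<longrightarrow> harmonic_on (interior K) h
        \<longrightarrow> (\<forall>z\<in>frontier K. u z \<le> ereal (h z)) \<longrightarrow> (\<forall>z\<in>K. u z \<le> ereal (h z)))"

definition psh_on :: "(complex^'n) set \<Rightarrow> (complex^'n \<Rightarrow> ereal) \<Rightarrow> bool" where
  "psh_on \<Omega> u \<longleftrightarrow> usc_on \<Omega> u \<and> (\<forall>x\<in>\<Omega>. u x < \<infinity>) \<and>
     (\<forall>a\<in>\<Omega>. \<forall>b. subharmonic_on {t. a + t *s b \<in> \<Omega>} (\<lambda>t. u (a + t *s b)))"

definition short_Ck :: "(complex^'n) set \<Rightarrow> bool" where
  "short_Ck \<Omega> \<longleftrightarrow> open \<Omega> \<and> connected \<Omega> \<and>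
     (\<exists>W::nat \<Rightarrow> (complex^'n) set. (\<forall>j. W j \<subseteq> W (Suc j)) \<and> \<Omega> = (\<Union>j. W j) \<and>
        (\<forall>j. biholomorphic (W j) (ball 0 1))) \<and>
     (\<forall>p\<in>\<Omega>. \<forall>v. kobayashi \<Omega> p v = 0) \<and>
     (\<exists>u. psh_on \<Omega> u \<and> (\<exists>M::real. \<forall>x\<in>\<Omega>. u x \<le> ereal M) \<and>
          \<not> (\<exists>c. \<forall>x\<in>\<Omega>. u x = c))"

definition fatou_bieberbach :: "(complex^'n) set \<Rightarrow> bool" where
  "fatou_bieberbach D \<longleftrightarrow> D \<noteq> UNIV \<and> connected D \<and> biholomorphic D UNIV"

end

theory Submission
  imports Defs "HOL-Complex_Analysis.Conformal_Mappings"
begin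

text \<open>
  Each set of \<open>k - 1\<close> coordinates is algebraically dependent on \<open>V\<close>, which yields for every \<open>i\<close> a
  nonzero polynomial \<open>p\<^sub>i\<close> independent of \<open>z\<^sub>i\<close> and vanishing on \<open>V\<close>. Choose \<open>q\<close> with all
  \<open>p\<^sub>i(q) \<noteq> 0\<close>. The overshears \<open>z\<^sub>i \<mapsto> z\<^sub>i exp (- ln 2 p\<^sub>i(q + z) / p\<^sub>i(q))\<close> fix \<open>V - q\<close> pointwise, and
  their composition has derivative \<open>1/2\<close> at the origin; its basin of attraction misses \<open>V - q\<close> and is
  biholomorphic to the whole space. It therefore suffices to find a Short domain containing a
  Fatou--Bieberbach domain without any constraint: a sublevel set of the Green function
  \<open>lim 2\<^sup>-\<^sup>n log\<^sup>+ |F\<^sup>n z|\<close> of a Henon-like map \<open>F\<close>, which contains the basin of \<open>F \<circ> F\<close> at the origin.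
\<close>

section \<open>Holomorphic maps and Cauchy estimates\<close>

text \<open>Codimension two enters as the count k - 1 > k - 2: a relation on \<open>V\<close> that
  avoids \<open>z_i\<close> is what makes the overshear in direction i invertible, and one is needed
  for every i so that the composition contracts all directions. All contraction rates are made equal
  so that the derivative at the fixed point is a multiple \<kappa> of the identity. Then \<kappa>^2
  < \<kappa>, the quadratic error of \<open>F\<close> is negligible against the linear part, and the
  rescaled iterates converge to a linearising map without any resonance condition. This is also why
  \<open>F\<close> is squared in the Henon-like case: its derivative at the origin is half a
  coordinate swap, and only the square is scalar there. The two automorphisms have separate tasks.
  The first supplies a copy X of the whole space inside the complement of \<open>V\<close>; the
  second supplies, in the whole space, a basin inside a sublevel set, and a chart carries this pair
  into X. The properties of a Short domain are checked directly on the image by composing iterates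
  with the chart. The basin lies in the sublevel set because an orbit tending to 0 eventually has
  norm below 1, while all the radii exceed 1.\<close>

lemma norm_cscale: "norm (c *s (v::complex^'n)) = norm c * norm v"
  unfolding norm_vec_def L2_set_right_distrib[OF norm_ge_zero] by (simp add: norm_mult)

lemma bounded_linear_cscale_left: "bounded_linear (\<lambda>h::complex. h *s (v::complex^'n))"
  by (rule bounded_linear_intro[where K = "norm v"])
     (auto simp: norm_cscale vec_eq_iff algebra_simps)

lemma has_derivative_complex_line:
  "((\<lambda>t. a + t *s (v::complex^'n)) has_derivative (\<lambda>h. h *s v)) (at t)"
proof -
  have "((\<lambda>t. a + t *s v) has_derivative (\<lambda>h. 0 + h *s v)) (at t)"
    by (intro derivative_intros bounded_linear.has_derivative[OF bounded_linear_cscale_left]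
        has_derivative_ident)
  then show ?thesis by simp
qed

lemma holo_map_frechet:
  assumes "holo_map U f" "x \<in> U"
  shows "(f has_derivative frechet_derivative f (at x)) (at x)"
    and "frechet_derivative f (at x) (c *s v) = c *s frechet_derivative f (at x) v"
proof -
  obtain L where L: "(f has_derivative L) (at x)" "\<forall>c v. L (c *s v) = c *s L v"
    using assms unfolding holo_map_def by blast
  have "L = frechet_derivative f (at x)"
    using frechet_derivative_at[OF L(1)] .
  with L show "(f has_derivative frechet_derivative f (at x)) (at x)"
    "frechet_derivative f (at x) (c *s v) = c *s frechet_derivative f (at x) v" by auto
qed

lemma holo_map_has_derivative_complex_linear:
  assumes "holo_map U f" "x \<in> U" "(f has_derivative L) (at x)"
  shows "L (c *s v) = c *s L v"
  using holo_map_frechet(2)[OF assms(1,2)] frechet_derivative_at[OF assms(3)] by simp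

lemma holo_map_mono: "holo_map U f \<Longrightarrow> W \<subseteq> U \<Longrightarrow> holo_map W f"
  unfolding holo_map_def by blast

lemma holo_map_continuous_on: "holo_map U f \<Longrightarrow> continuous_on U f"
  unfolding holo_map_def
  by (metis continuous_at_imp_continuous_on has_derivative_continuous)

lemma holo_map_compose:
  assumes f: "holo_map U f" and g: "holo_map W g" and "f ` U \<subseteq> W"
  shows "holo_map U (\<lambda>x. g (f x))"
  unfolding holo_map_def
proof
  fix x assume x: "x \<in> U"
  then have fx: "f x \<in> W" using assms by auto
  let ?L = "\<lambda>h. frechet_derivative g (at (f x)) (frechet_derivative f (at x) h)"
  have "((\<lambda>x. g (f x)) has_derivative ?L) (at x)"
    by (rule has_derivative_compose[OF holo_map_frechet(1)[OF f x] holo_map_frechet(1)[OF g fx]])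
  moreover have "\<forall>c v. ?L (c *s v) = c *s ?L v"
    by (simp add: holo_map_frechet(2)[OF f x] holo_map_frechet(2)[OF g fx])
  ultimately show "\<exists>L. ((\<lambda>x. g (f x)) has_derivative L) (at x) \<and> (\<forall>c v. L (c *s v) = c *s L v)"
    by blast
qed

lemma holo_map_id: "holo_map U (\<lambda>x. x)"
  unfolding holo_map_def by (blast intro: has_derivative_ident)

lemma holo_map_funpow:
  fixes f :: "complex^'n \<Rightarrow> complex^'n"
  shows "holo_map UNIV f \<Longrightarrow> holo_map UNIV (f ^^ n)"
proof (induction n)
  case (Suc n)
  from holo_map_compose[OF Suc.IH[OF Suc.prems] Suc.prems subset_UNIV] show ?case by (simp add: o_def)
qed (simp add: holo_map_id id_def)

lemma holo_map_scaleR_add: "holo_map U (\<lambda>x. r *\<^sub>R x + a)"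
  unfolding holo_map_def
proof
  fix x :: "complex^'a"
  have "((\<lambda>x. r *\<^sub>R x + a) has_derivative (\<lambda>h. r *\<^sub>R h + 0)) (at x)"
    by (intro derivative_intros)
  then show "\<exists>L. ((\<lambda>x. r *\<^sub>R x + a) has_derivative L) (at x) \<and> (\<forall>c v. L (c *s v) = c *s L v)"
    by (intro exI conjI, assumption) (simp add: vec_eq_iff scaleR_conv_of_real)
qed

lemma holo_map_diff:
  assumes f: "holo_map U f" and g: "holo_map U g"
  shows "holo_map U (\<lambda>x. f x - g x)"
  unfolding holo_map_def
proof
  fix x assume x: "x \<in> U"
  let ?L = "\<lambda>h. frechet_derivative f (at x) h - frechet_derivative g (at x) h"
  have "((\<lambda>x. f x - g x) has_derivative ?L) (at x)"
    by (intro derivative_intros holo_map_frechet(1)[OF f x] holo_map_frechet(1)[OF g x])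
  moreover have "\<forall>c v. ?L (c *s v) = c *s ?L v"
    by (simp add: holo_map_frechet(2)[OF f x] holo_map_frechet(2)[OF g x] vec_eq_iff algebra_simps)
  ultimately show "\<exists>L. ((\<lambda>x. f x - g x) has_derivative L) (at x) \<and> (\<forall>c v. L (c *s v) = c *s L v)"
    by blast
qed

lemma holo_map_along_curve:
  assumes "holo_map U f" "x \<in> U" "\<phi> t = x" "(f has_derivative L) (at x)"
    and "(\<phi> has_derivative (\<lambda>h. h *s v)) (at t)"
  shows "((\<lambda>t. f (\<phi> t)) has_derivative (\<lambda>h. h *s L v)) (at t)"
proof -
  have "((\<lambda>t. f (\<phi> t)) has_derivative (\<lambda>h. L (h *s v))) (at t)"
    by (rule has_derivative_compose) (use assms in auto)
  then show ?thesis
    by (simp add: holo_map_has_derivative_complex_linear[OF assms(1,2,4)])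
qed

section \<open>Cauchy estimates for derivatives\<close>

lemma curve_component_field_derivative:
  assumes "(\<phi> has_derivative (\<lambda>h. h *s (w::complex^'n))) (at t)"
  shows "((\<lambda>t. \<phi> t $ i) has_field_derivative w $ i) (at t)"
proof -
  have "((\<lambda>t. \<phi> t $ i) has_derivative (\<lambda>h. (h *s w) $ i)) (at t)"
    by (rule bounded_linear.has_derivative[OF bounded_linear_vec_nth assms])
  then show ?thesis
    by (simp add: has_field_derivative_def mult.commute[of _ "w $ i"] cong: if_cong)
qed

text \<open>The one-variable Cauchy inequality bounds each component of \<open>w\<close> by
  \<open>B / r\<close>; summing the components costs the factor \<open>CARD('n)\<close>.\<close>

lemma Cauchy_estimate_curve:
  fixes \<phi> :: "complex \<Rightarrow> complex^'n"
  assumes r: "r > 0"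
    and hol: "\<And>t. t \<in> cball 0 r \<Longrightarrow> \<exists>w. (\<phi> has_derivative (\<lambda>h. h *s w)) (at t)"
    and B: "\<And>t. t \<in> cball 0 r \<Longrightarrow> norm (\<phi> t) \<le> B"
    and w: "(\<phi> has_derivative (\<lambda>h. h *s w)) (at 0)"
  shows "norm w \<le> real CARD('n) * B / r"
proof -
  have "norm (w $ i) \<le> B / r" for i
  proof -
    let ?g = "\<lambda>t. \<phi> t $ i"
    have fd: "\<exists>d. (?g has_field_derivative d) (at t)" if "t \<in> cball 0 r" for t
      using hol[OF that] curve_component_field_derivative by blast
    have "norm ((deriv ^^ 1) ?g 0) \<le> fact 1 * B / r ^ 1"
    proof (rule Cauchy_inequality)
      show "?g holomorphic_on ball 0 r"
        by (rule holomorphic_onI)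
           (metis fd ball_subset_cball field_differentiable_at_within field_differentiable_def subsetD)
      show "continuous_on (cball 0 r) ?g"
        by (rule continuous_at_imp_continuous_on) (metis fd DERIV_isCont)
      show "norm (?g x) \<le> B" if "norm (0 - x) = r" for x
        using order_trans[OF Finite_Cartesian_Product.norm_nth_le B[of x]] that by simp
    qed (use r in auto)
    moreover have "deriv ?g 0 = w $ i"
      by (rule DERIV_imp_deriv[OF curve_component_field_derivative[OF w]])
    ultimately show ?thesis by simp
  qed
  then have "(\<Sum>i\<in>UNIV. norm (w $ i)) \<le> real CARD('n) * (B / r)"
    by (rule sum_bounded_above)
  moreover have "norm w \<le> (\<Sum>i\<in>UNIV. norm (w $ i))"
    unfolding norm_vec_def by (rule L2_set_le_sum) simp
  ultimately show ?thesis by simp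
qed

text \<open>On the complex line through \<open>x\<close> in direction \<open>v\<close>, the disc of
  parameter radius \<open>r / norm v\<close> stays in the ball, so the estimate for curves
  applies.\<close>

lemma Cauchy_estimate:
  fixes f :: "complex^'n \<Rightarrow> complex^'m"
  assumes f: "holo_map U f" and sub: "cball x r \<subseteq> U" and r: "r > 0"
    and B: "\<And>y. y \<in> cball x r \<Longrightarrow> norm (f y) \<le> B"
    and L: "(f has_derivative L) (at x)"
  shows "norm (L v) \<le> real CARD('m) * B / r * norm v"
proof (cases "v = 0")
  case True
  then show ?thesis using linear_0[OF has_derivative_linear[OF L]] by simp
next
  case False
  let ?\<phi> = "\<lambda>t. x + t *s v"
  have in_ball: "?\<phi> t \<in> cball x r" if "t \<in> cball 0 (r / norm v)" for t
    using that False by (simp add: norm_cscale dist_norm field_simps)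
  have xU: "x \<in> U" using sub r by auto
  have "norm (L v) \<le> real CARD('m) * B / (r / norm v)"
  proof (rule Cauchy_estimate_curve[where \<phi> = "\<lambda>t. f (?\<phi> t)"])
    show "\<exists>w. ((\<lambda>t. f (?\<phi> t)) has_derivative (\<lambda>h. h *s w)) (at t)" if "t \<in> cball 0 (r / norm v)" for t
      using holo_map_along_curve[OF f _ refl holo_map_frechet(1)[OF f] has_derivative_complex_line]
        in_ball[OF that] sub by blast
    show "((\<lambda>t. f (?\<phi> t)) has_derivative (\<lambda>h. h *s L v)) (at 0)"
      by (rule holo_map_along_curve[OF f xU _ L has_derivative_complex_line]) simp
  qed (use in_ball B False r in auto)
  then show ?thesis by simp
qed

text \<open>Two Cauchy estimates replace second derivatives: the first bounds the derivative, hence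
  makes \<open>f\<close> Lipschitz; the second is applied to a translate of \<open>f\<close> minus
  \<open>f\<close>, which is small by the first. The result yields both continuity of the derivative
  for the inverse function theorem and the quadratic error at a fixed point.\<close>

lemma holo_map_derivative_Lipschitz:
  fixes f :: "complex^'n \<Rightarrow> complex^'m"
  assumes f: "holo_map U f" and U: "open U" and a: "a \<in> U"
  obtains C \<delta> where "C \<ge> 0" "\<delta> > 0" "ball a \<delta> \<subseteq> U"
    "\<And>x y v. x \<in> ball a \<delta> \<Longrightarrow> y \<in> ball a \<delta> \<Longrightarrow>
       norm (frechet_derivative f (at x) v - frechet_derivative f (at y) v) \<le> C * norm (x - y) * norm v"
proof -
  let ?K = "real CARD('m)" and ?D = "\<lambda>x. frechet_derivative f (at x)"
  obtain e where e: "e > 0" "cball a e \<subseteq> U" using U a open_contains_cball by blast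
  \<comment> \<open>The quarter leaves room for a bound on \<open>f\<close> at radius
    \<open>4 * \<delta>\<close>, a Lipschitz bound at radius \<open>3 * \<delta>\<close>, and Cauchy
    balls of radius \<open>\<delta>\<close> around points of \<open>ball a \<delta>\<close>, also
    after a translation.\<close>
  define \<delta> where "\<delta> = e / 4"
  have \<delta>: "\<delta> > 0" "cball a (4 * \<delta>) \<subseteq> U" using e by (auto simp: \<delta>_def)
  have "bounded (f ` cball a (4 * \<delta>))"
    by (intro compact_imp_bounded compact_continuous_image compact_cball
        continuous_on_subset[OF holo_map_continuous_on[OF f] \<delta>(2)])
  then obtain B where B: "B > 0" "\<And>y. y \<in> cball a (4 * \<delta>) \<Longrightarrow> norm (f y) \<le> B"
    by (auto simp: bounded_pos)
  define M where "M = ?K * B / \<delta>"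
  have M0: "M \<ge> 0" using B \<delta> by (simp add: M_def)
  have Db: "norm (?D x v) \<le> M * norm v" if "x \<in> cball a (3 * \<delta>)" for x v
  proof -
    have sub: "cball x \<delta> \<subseteq> cball a (4 * \<delta>)"
      using that by (auto simp: cball_def) (smt (verit) dist_triangle)
    show ?thesis unfolding M_def
      by (rule Cauchy_estimate[OF f _ \<delta>(1) _ holo_map_frechet(1)[OF f]])
         (use sub \<delta> B(2) that in auto)
  qed
  have Lip: "norm (f x - f y) \<le> M * norm (x - y)" if "x \<in> cball a (3 * \<delta>)" "y \<in> cball a (3 * \<delta>)" for x y
  proof (rule differentiable_bound[OF convex_cball[of a "3 * \<delta>"] _ _ that, where f' = ?D])
    fix x assume x: "x \<in> cball a (3 * \<delta>)"
    then have "x \<in> U" using \<delta> by auto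
    then show "(f has_derivative ?D x) (at x within cball a (3 * \<delta>))"
      by (rule has_derivative_at_withinI[OF holo_map_frechet(1)[OF f]])
    show "onorm (?D x) \<le> M" by (rule onorm_le[OF Db[OF x]])
  qed
  have "norm (?D x v - ?D y v) \<le> (?K * M / \<delta>) * norm (x - y) * norm v"
    if x: "x \<in> ball a \<delta>" and y: "y \<in> ball a \<delta>" for x y v
  proof -
    \<comment> \<open>The derivative of \<open>?g\<close> at \<open>y\<close> is exactly the
      difference of the derivatives of \<open>f\<close> at \<open>x\<close> and \<open>y\<close>.
      The factor 1 gives the shift the shape of \<open>holo_map_scaleR_add\<close>.\<close>
    let ?g = "\<lambda>z. f (1 *\<^sub>R z + (x - y)) - f z"
    let ?W = "ball y (2 * \<delta>)"
    have W: "z \<in> U" "1 *\<^sub>R z + (x - y) \<in> U" if "z \<in> ?W" for z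
    proof -
      have "norm (a - z) \<le> norm (a - y) + norm (y - z)" "norm (a - (z + (x - y))) \<le> norm (a - x) + norm (y - z)"
        using norm_triangle_ineq[of "a - y" "y - z"] norm_triangle_ineq[of "a - x" "y - z"]
        by (auto simp: algebra_simps)
      then have "z \<in> cball a (4 * \<delta>)" "z + (x - y) \<in> cball a (4 * \<delta>)"
        using that x y \<delta>(1) by (auto simp: dist_norm)
      then show "z \<in> U" "1 *\<^sub>R z + (x - y) \<in> U" using \<delta> by auto
    qed
    have g: "holo_map ?W ?g"
      by (intro holo_map_diff holo_map_compose[OF holo_map_scaleR_add f] holo_map_mono[OF f])
         (use W in auto)
    have "norm (?D x v - ?D y v) \<le> ?K * (M * norm (x - y)) / \<delta> * norm v"
    proof (rule Cauchy_estimate[OF g _ \<delta>(1)])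
      show "cball y \<delta> \<subseteq> ?W" using \<delta> by auto
      show "norm (?g z) \<le> M * norm (x - y)" if "z \<in> cball y \<delta>" for z
      proof -
        have "norm (a - z) \<le> norm (a - y) + norm (y - z)" "norm (a - (z + (x - y))) \<le> norm (a - x) + norm (y - z)"
          using norm_triangle_ineq[of "a - y" "y - z"] norm_triangle_ineq[of "a - x" "y - z"]
          by (auto simp: algebra_simps)
        then have "z \<in> cball a (3 * \<delta>)" "z + (x - y) \<in> cball a (3 * \<delta>)"
          using that x y \<delta>(1) by (auto simp: dist_norm)
        from Lip[OF this(2,1)] show ?thesis by simp
      qed
      have "x \<in> U" "y \<in> U" using x y \<delta> by auto
      note D = holo_map_frechet(1)[OF f this(1)] holo_map_frechet(1)[OF f this(2)]
      have "((\<lambda>z. 1 *\<^sub>R z + (x - y)) has_derivative (\<lambda>h. h)) (at y)"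
        by (auto intro!: derivative_eq_intros)
      from has_derivative_compose[OF this, of f "?D x"] D(1)
      have "((\<lambda>z. f (1 *\<^sub>R z + (x - y))) has_derivative ?D x) (at y)" by simp
      then show "(?g has_derivative (\<lambda>v. ?D x v - ?D y v)) (at y)"
        by (rule has_derivative_diff[OF _ D(2)])
    qed
    then show ?thesis by (simp add: field_simps)
  qed
  moreover have "ball a \<delta> \<subseteq> U" using \<delta> by (auto simp: subset_iff)
  ultimately show ?thesis using that[of "?K * M / \<delta>" \<delta>] M0 \<delta> by auto
qed

text \<open>Weierstrass' theorem: Cauchy estimates on \<open>f n - f m\<close> turn uniform
  convergence of the maps into locally uniform convergence of their derivatives, after which the
  theorem on differentiating sequences applies. Complex linearity passes to the pointwise
  limit.\<close>

lemma holo_map_uniform_limit: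
  fixes f :: "nat \<Rightarrow> complex^'n \<Rightarrow> complex^'m"
  assumes f: "\<And>n. holo_map (ball a r) (f n)"
    and lim: "uniform_limit (ball a r) f g sequentially"
  shows "holo_map (ball a r) g"
    and "x \<in> ball a r \<Longrightarrow>
      (\<lambda>n. frechet_derivative (f n) (at x) v) \<longlonglongrightarrow> frechet_derivative g (at x) v"
proof -
  let ?D = "\<lambda>n x. frechet_derivative (f n) (at x)"
  have *: "\<exists>L. (g has_derivative L) (at x) \<and> (\<forall>c v. L (c *s v) = c *s L v) \<and> (\<forall>v. (\<lambda>n. ?D n x v) \<longlonglongrightarrow> L v)"
    if x: "x \<in> ball a r" for x
  proof -
    obtain e where e: "e > 0" "ball x e \<subseteq> ball a r" using x by (meson open_ball open_contains_ball)
    define \<rho> where "\<rho> = e / 2"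
    have \<rho>: "\<rho> > 0" "ball x (2 * \<rho>) \<subseteq> ball a r" using e by (auto simp: \<rho>_def)
    let ?S = "ball x \<rho>" and ?K = "real CARD('m)"
    have cb: "cball y \<rho> \<subseteq> ball a r" if "y \<in> ?S" for y
    proof -
      have "z \<in> ball x (2 * \<rho>)" if "z \<in> cball y \<rho>" for z
        using that \<open>y \<in> ?S\<close> dist_triangle[of x z y] by auto
      then show ?thesis using \<rho> by blast
    qed
    have cau: "\<exists>N. \<forall>n\<ge>N. \<forall>m\<ge>N. \<forall>y\<in>?S. \<forall>h. norm (?D n y h - ?D m y h) \<le> \<epsilon> * norm h" if "\<epsilon> > 0" for \<epsilon>
    proof -
      define \<eta> where "\<eta> = \<epsilon> * \<rho> / (2 * ?K)"
      have \<eta>: "\<eta> > 0" using that \<rho> by (simp add: \<eta>_def)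
      from uniform_limitD[OF lim \<eta>] obtain N where
        N: "\<And>n y. n \<ge> N \<Longrightarrow> y \<in> ball a r \<Longrightarrow> dist (f n y) (g y) < \<eta>"
        unfolding eventually_sequentially by blast
      have "norm (?D n y h - ?D m y h) \<le> \<epsilon> * norm h" if nm: "n \<ge> N" "m \<ge> N" and y: "y \<in> ?S" for n m y h
      proof -
        have "y \<in> cball y \<rho>" using \<rho> by simp
        then have yb: "y \<in> ball a r" using cb[OF y] by blast
        have "norm (?D n y h - ?D m y h) \<le> ?K * (2 * \<eta>) / \<rho> * norm h"
        proof (rule Cauchy_estimate[OF holo_map_diff[OF f[of n] f[of m]] cb[OF y] \<rho>(1)])
          show "norm (f n z - f m z) \<le> 2 * \<eta>" if "z \<in> cball y \<rho>" for z
          proof -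
            have "z \<in> ball a r" using cb[OF y] that by blast
            from N[OF nm(1) this] N[OF nm(2) this] show ?thesis
              using dist_triangle2[of "f n z" "f m z" "g z"] by (simp add: dist_norm)
          qed
          show "((\<lambda>z. f n z - f m z) has_derivative (\<lambda>h. ?D n y h - ?D m y h)) (at y)"
            by (intro has_derivative_diff holo_map_frechet(1)[OF f yb])
        qed
        also have "?K * (2 * \<eta>) / \<rho> = \<epsilon>" using \<rho> by (simp add: \<eta>_def)
        finally show ?thesis .
      qed
      then show ?thesis by blast
    qed
    have "Cauchy (\<lambda>n. ?D n y h)" if y: "y \<in> ?S" for y h
    proof (rule CauchyI)
      fix e :: real assume "e > 0"
      then have "e / (norm h + 1) > 0" by (simp add: add_nonneg_pos)
      from cau[OF this] obtain N where N: "\<And>n m. n \<ge> N \<Longrightarrow> m \<ge> N \<Longrightarrow> norm (?D n y h - ?D m y h) \<le> e / (norm h + 1) * norm h"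
        using y by blast
      have "e / (norm h + 1) * norm h < e"
        using \<open>e > 0\<close> mult_strict_left_mono[of "norm h / (norm h + 1)" 1 e] add_nonneg_pos[OF norm_ge_zero[of h], of 1]
        by (simp add: divide_less_eq)
      then show "\<exists>M. \<forall>m\<ge>M. \<forall>n\<ge>M. norm (?D m y h - ?D n y h) < e"
        using N by (meson le_less_trans)
    qed
    note conv = this[THEN Cauchy_convergent_iff[THEN iffD1]]
    define g' where "g' y h = lim (\<lambda>n. ?D n y h)" for y h
    have g': "(\<lambda>n. ?D n y h) \<longlonglongrightarrow> g' y h" if "y \<in> ?S" for y h
      unfolding g'_def by (rule convergent_LIMSEQ_iff[THEN iffD1, OF conv[OF that]])
    have d1: "(f n has_derivative ?D n y) (at y within ?S)" if "y \<in> ?S" for n y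
    proof (rule has_derivative_at_withinI[OF holo_map_frechet(1)[OF f]])
      have "y \<in> cball y \<rho>" using \<rho> by simp
      then show "y \<in> ball a r" using cb[OF that] by blast
    qed
    have d2: "\<forall>\<^sub>F n in sequentially. \<forall>y\<in>?S. \<forall>h. norm (?D n y h - g' y h) \<le> e * norm h" if "e > 0" for e
    proof -
      obtain N where N: "\<And>n m y h. n \<ge> N \<Longrightarrow> m \<ge> N \<Longrightarrow> y \<in> ?S \<Longrightarrow> norm (?D n y h - ?D m y h) \<le> e * norm h"
        using cau[OF \<open>e > 0\<close>] by blast
      have "norm (?D n y h - g' y h) \<le> e * norm h" if n: "n \<ge> N" and y: "y \<in> ?S" for n y h
      proof (rule LIMSEQ_le_const2)
        show "(\<lambda>m. norm (?D n y h - ?D m y h)) \<longlonglongrightarrow> norm (?D n y h - g' y h)"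
          by (intro tendsto_norm tendsto_diff tendsto_const g' y)
        show "\<exists>M. \<forall>m\<ge>M. norm (?D n y h - ?D m y h) \<le> e * norm h"
          using N[OF n _ y] by blast
      qed
      then show ?thesis unfolding eventually_sequentially by blast
    qed
    have xS: "x \<in> ?S" using \<rho> by simp
    have "\<exists>g2. \<forall>y\<in>?S. (\<lambda>n. f n y) \<longlonglongrightarrow> g2 y \<and> (g2 has_derivative g' y) (at y within ?S)"
      by (rule has_derivative_sequence[OF convex_ball d1 d2 xS tendsto_uniform_limitI[OF lim x]])
    then obtain g2 where g2: "\<And>y. y \<in> ?S \<Longrightarrow> (\<lambda>n. f n y) \<longlonglongrightarrow> g2 y"
      "\<And>y. y \<in> ?S \<Longrightarrow> (g2 has_derivative g' y) (at y within ?S)" by blast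
    have "(g2 has_derivative g' x) (at x)"
      using g2(2)[OF xS] at_within_open[OF xS] by simp
    moreover have "g2 y = g y" if "y \<in> ?S" for y
    proof -
      have "y \<in> cball y \<rho>" using \<rho> by simp
      then have "y \<in> ball a r" using cb[OF that] by blast
      from LIMSEQ_unique[OF g2(1)[OF that] tendsto_uniform_limitI[OF lim this]] show ?thesis .
    qed
    ultimately have "(g has_derivative g' x) (at x)"
      using has_derivative_transform_within_open[of g2 "g' x" x UNIV ?S g] xS by auto
    moreover have "g' x (c *s v) = c *s g' x v" for c v
    proof (rule LIMSEQ_unique[OF g'[OF xS]])
      show "(\<lambda>n. ?D n x (c *s v)) \<longlonglongrightarrow> c *s g' x v"
        unfolding holo_map_frechet(2)[OF f x]
        by (rule vec_tendstoI) (auto intro!: tendsto_intros tendsto_vec_nth[OF g'[OF xS]])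
    qed
    ultimately show ?thesis using g'[OF xS] by blast
  qed
  then show "holo_map (ball a r) g" unfolding holo_map_def by blast
  show "(\<lambda>n. ?D n x v) \<longlonglongrightarrow> frechet_derivative g (at x) v" if "x \<in> ball a r"
    using *[OF that] frechet_derivative_at[of g _ x] by auto
qed

text \<open>The real inverse function theorem does the work; the inverse is holomorphic because the
  inverse of a complex-linear bijection is complex-linear.\<close>

lemma holo_map_local_inverse:
  fixes f :: "complex^'n \<Rightarrow> complex^'n"
  assumes f: "holo_map U f" and U: "open U" and x0: "x0 \<in> U"
    and D: "frechet_derivative f (at x0) = (\<lambda>v. v)"
  obtains U' V g where "open U'" "U' \<subseteq> U" "x0 \<in> U'" "open V" "f x0 \<in> V" "homeomorphism U' V f g"
    "holo_map V g"
proof -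
  define f' where "f' x = Blinfun (frechet_derivative f (at x))" for x
  have f': "blinfun_apply (f' x) = frechet_derivative f (at x)" if "x \<in> U" for x
    unfolding f'_def
    by (rule bounded_linear_Blinfun_apply[OF has_derivative_bounded_linear[OF holo_map_frechet(1)[OF f that]]])
  have cont: "continuous_on U f'"
  proof (rule continuous_at_imp_continuous_on, rule ballI)
    fix a assume a: "a \<in> U"
    obtain C \<delta> where C: "C \<ge> 0" "\<delta> > 0" "ball a \<delta> \<subseteq> U"
      "\<And>x y v. x \<in> ball a \<delta> \<Longrightarrow> y \<in> ball a \<delta> \<Longrightarrow>
       norm (frechet_derivative f (at x) v - frechet_derivative f (at y) v) \<le> C * norm (x - y) * norm v"
      by (rule holo_map_derivative_Lipschitz[OF f U a]) (rule that)
    have b: "norm (f' x - f' a) \<le> C * norm (x - a)" if "x \<in> ball a \<delta>" for x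
    proof (rule norm_blinfun_bound)
      show "norm (blinfun_apply (f' x - f' a) v) \<le> C * norm (x - a) * norm v" for v
        using C(4)[of x a v] C(2,3) that a f'[of x] f'[of a] by (auto simp: blinfun.diff_left)
    qed (use C in auto)
    have "((\<lambda>x. f' x - f' a) \<longlongrightarrow> 0) (at a)"
    proof (rule Lim_null_comparison)
      show "\<forall>\<^sub>F x in at a. norm (f' x - f' a) \<le> C * norm (x - a)"
        unfolding eventually_at using C(2) b by (auto simp: dist_commute intro!: exI[of _ \<delta>])
      show "((\<lambda>x. C * norm (x - a)) \<longlongrightarrow> 0) (at a)"
        by (auto intro!: tendsto_eq_intros)
    qed
    then show "isCont f' a" unfolding isCont_def using LIM_zero_iff by blast
  qed
  have id: "id_blinfun o\<^sub>L f' x0 = id_blinfun"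
    by (rule blinfun_eqI) (simp add: f'[OF x0] D)
  obtain U' V g g' where *: "open U'" "U' \<subseteq> U" "x0 \<in> U'" "open V" "f x0 \<in> V" "homeomorphism U' V f g"
    "\<And>y. y \<in> V \<Longrightarrow> (g has_derivative (g' y)) (at y)"
    "\<And>y. y \<in> V \<Longrightarrow> g' y = inv (blinfun_apply (f'(g y)))"
    "\<And>y. y \<in> V \<Longrightarrow> bij (blinfun_apply (f'(g y)))"
    using inverse_function_theorem[OF U _ cont x0 id] f' holo_map_frechet(1)[OF f] by metis
  have "holo_map V g" unfolding holo_map_def
  proof
    fix y assume y: "y \<in> V"
    then have "g y \<in> U" using *(2,6) by (auto simp: homeomorphism_def)
    let ?A = "frechet_derivative f (at (g y))"
    have bij: "bij ?A" and g': "g' y = inv ?A" using *(8,9)[OF y] f'[OF \<open>g y \<in> U\<close>] by auto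
    have "g' y (c *s v) = c *s g' y v" for c v
    proof -
      have "?A (c *s inv ?A v) = c *s v"
        using holo_map_frechet(2)[OF f \<open>g y \<in> U\<close>] bij by (simp add: bij_is_surj surj_f_inv_f)
      then show ?thesis unfolding g' using bij by (metis bij_inv_eq_iff)
    qed
    then show "\<exists>L. (g has_derivative L) (at y) \<and> (\<forall>c v. L (c *s v) = c *s L v)"
      using *(7)[OF y] by blast
  qed
  with * show ?thesis using that by blast
qed

text \<open>In contrast to \<open>biholomorphic\<close>, both maps are named so that they can be
  composed with iterates later; openness is tracked separately.\<close>

definition biholomorphism ::
  "(complex^'n) set \<Rightarrow> (complex^'n) set \<Rightarrow> (complex^'n \<Rightarrow> complex^'n) \<Rightarrow> (complex^'n \<Rightarrow> complex^'n) \<Rightarrow> bool" where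
  "biholomorphism A B f g \<longleftrightarrow> holo_map A f \<and> holo_map B g \<and> f ` A = B \<and> g ` B = A \<and>
     (\<forall>x\<in>A. g (f x) = x) \<and> (\<forall>y\<in>B. f (g y) = y)"

section \<open>Basins of attraction\<close>

lemma funpow_left_inverse:
  fixes f g :: "'a \<Rightarrow> 'a"
  assumes "\<And>x. g (f x) = x"
  shows "(g ^^ n) ((f ^^ n) x) = x"
  by (induction n arbitrary: x) (simp_all add: assms funpow_swap1)

locale attracting_automorphism =
  fixes F G :: "complex^'n \<Rightarrow> complex^'n" and \<kappa> :: real
  assumes F: "holo_map UNIV F" and G: "holo_map UNIV G"
    and GF: "G (F x) = x" and FG: "F (G x) = x"
    and F0: "F 0 = 0" and DF0: "(F has_derivative (\<lambda>h. \<kappa> *\<^sub>R h)) (at 0)"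
    and \<kappa>: "0 < \<kappa>" "\<kappa> < 1"
begin

definition basin :: "(complex^'n) set" where
  "basin = {z. (\<lambda>n. (F ^^ n) z) \<longlonglongrightarrow> 0}"

text \<open>The linearising map: on the basin it conjugates \<open>F\<close> to multiplication by
  \<open>\<kappa>\<close>. Where the sequence diverges, \<open>lim\<close> has an unspecified
  value.\<close>

definition koenigs :: "complex^'n \<Rightarrow> complex^'n" where
  "koenigs z = lim (\<lambda>n. (1 / \<kappa> ^ n) *\<^sub>R (F ^^ n) z)"

text \<open>The derivative of the error \<open>F x - \<kappa> *\<^sub>R x\<close> vanishes at 0 and
  is Lipschitz, hence is at most a multiple of \<open>norm x\<close> on the ball of radius
  \<open>norm x\<close>; the mean value inequality gives one more factor
  \<open>norm x\<close>.\<close>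

lemma quadratic_bound:
  obtains C \<delta> where "C \<ge> 0" "\<delta> > 0" "\<And>x. x \<in> ball 0 \<delta> \<Longrightarrow> norm (F x - \<kappa> *\<^sub>R x) \<le> C * (norm x)\<^sup>2"
proof -
  let ?D = "\<lambda>x. frechet_derivative F (at x)"
  obtain C \<delta> where C: "C \<ge> 0" "\<delta> > 0" "ball 0 \<delta> \<subseteq> (UNIV :: (complex^'n) set)"
    "\<And>x y v. x \<in> ball 0 \<delta> \<Longrightarrow> y \<in> ball 0 \<delta> \<Longrightarrow> norm (?D x v - ?D y v) \<le> C * norm (x - y) * norm v"
    by (rule holo_map_derivative_Lipschitz[OF F open_UNIV UNIV_I, of 0]) (rule that)
  have D0: "?D 0 = (\<lambda>h. \<kappa> *\<^sub>R h)" by (rule frechet_derivative_at[OF DF0, symmetric])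
  have "norm (F x - \<kappa> *\<^sub>R x) \<le> C * (norm x)\<^sup>2" if x: "x \<in> ball 0 \<delta>" for x
  proof -
    let ?H = "\<lambda>x. F x - \<kappa> *\<^sub>R x" and ?H' = "\<lambda>y h. ?D y h - \<kappa> *\<^sub>R h"
    have der: "(?H has_derivative ?H' y) (at y within cball 0 (norm x))" for y
      by (intro has_derivative_diff has_derivative_scaleR_right has_derivative_ident
          has_derivative_at_withinI[OF holo_map_frechet(1)[OF F UNIV_I]])
    have on: "onorm (?H' y) \<le> C * norm x" if y: "y \<in> cball 0 (norm x)" for y
    proof (rule onorm_le)
      fix h
      have "norm (?D y h - \<kappa> *\<^sub>R h) \<le> C * norm y * norm h"
        using C(4)[of y 0 h] x y C(2) by (simp add: D0)
      also have "\<dots> \<le> C * norm x * norm h"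
        using y C(1) by (intro mult_right_mono mult_left_mono) auto
      finally show "norm (?D y h - \<kappa> *\<^sub>R h) \<le> C * norm x * norm h" .
    qed
    have "norm (?H x - ?H 0) \<le> C * norm x * norm (x - 0)"
      by (rule differentiable_bound[OF convex_cball der on]) auto
    then show ?thesis by (simp add: F0 power2_eq_square)
  qed
  then show ?thesis using that C by blast
qed

lemma koenigs_local:
  obtains \<delta> where "\<delta> > 0" "ball 0 \<delta> \<subseteq> basin"
    "uniform_limit (ball 0 \<delta>) (\<lambda>n x. (1 / \<kappa> ^ n) *\<^sub>R (F ^^ n) x) koenigs sequentially"
proof -
  obtain C \<delta>0 where C: "C \<ge> 0" "\<delta>0 > 0" "\<And>x. x \<in> ball 0 \<delta>0 \<Longrightarrow> norm (F x - \<kappa> *\<^sub>R x) \<le> C * (norm x)\<^sup>2"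
    using quadratic_bound by blast
  \<comment> \<open>Two demands fix \<open>\<mu>\<close>: being above \<open>\<kappa>\<close> makes
    it a contraction rate of \<open>F\<close> near 0, and \<open>\<mu>\<^sup>2 < \<kappa>\<close>
    makes the differences of consecutive rescaled iterates a geometric series, since the quadratic
    error is of order \<open>\<mu> ^ (2 * n)\<close> and is divided by
    \<open>\<kappa> ^ Suc n\<close>.\<close>
  have "\<kappa> < sqrt \<kappa>" using \<kappa> by (intro real_less_rsqrt) (simp add: power2_eq_square)
  then obtain \<mu> where \<mu>: "\<kappa> < \<mu>" "\<mu> < sqrt \<kappa>" using dense by blast
  have \<mu>2: "\<mu>\<^sup>2 < \<kappa>" using \<mu> \<kappa> power_strict_mono[of \<mu> "sqrt \<kappa>" 2] by simp
  have "sqrt \<kappa> < 1" using \<kappa> by simp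
  then have \<mu>01: "0 < \<mu>" "\<mu> < 1" using \<mu> \<kappa> by linarith+
  define \<delta> where "\<delta> = min \<delta>0 ((\<mu> - \<kappa>) / (C + 1))"
  have \<delta>: "\<delta> > 0" using C \<mu> by (simp add: \<delta>_def)
  have "C * \<delta> \<le> (C + 1) * ((\<mu> - \<kappa>) / (C + 1))"
    using C \<delta> by (intro mult_mono) (auto simp: \<delta>_def)
  then have C\<delta>: "C * \<delta> \<le> \<mu> - \<kappa>" using C by simp
  have contr: "norm (F x) \<le> \<mu> * norm x" if "x \<in> ball 0 \<delta>" for x
  proof -
    have "norm (F x) \<le> norm (\<kappa> *\<^sub>R x) + norm (F x - \<kappa> *\<^sub>R x)" by (metis add.commute diff_add_cancel norm_triangle_ineq)
    also have "\<dots> \<le> \<kappa> * norm x + C * (norm x)\<^sup>2" using C(3)[of x] that \<kappa> by (simp add: \<delta>_def)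
    also have "C * (norm x)\<^sup>2 \<le> C * \<delta> * norm x"
      using that C(1) by (simp add: power2_eq_square mult_left_mono mult_right_mono mult.assoc[symmetric])
    also have "\<dots> \<le> (\<mu> - \<kappa>) * norm x" by (rule mult_right_mono[OF C\<delta>]) simp
    finally show ?thesis by (simp add: algebra_simps)
  qed
  have it: "norm ((F ^^ n) x) \<le> \<mu> ^ n * norm x" if x: "x \<in> ball 0 \<delta>" for x n
  proof (induction n)
    case (Suc n)
    have "\<mu> ^ n * norm x \<le> 1 * norm x" using \<mu>01 by (intro mult_right_mono power_le_one) auto
    then have "(F ^^ n) x \<in> ball 0 \<delta>" using Suc x by simp
    from contr[OF this] have "norm ((F ^^ Suc n) x) \<le> \<mu> * norm ((F ^^ n) x)" by simp
    also have "\<dots> \<le> \<mu> * (\<mu> ^ n * norm x)" using Suc \<mu>01 by (intro mult_left_mono) auto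
    finally show ?case by (simp add: mult.assoc)
  qed simp
  have inb: "(F ^^ n) x \<in> ball 0 \<delta>" if x: "x \<in> ball 0 \<delta>" for x n
  proof -
    have "\<mu> ^ n * norm x \<le> 1 * norm x" using \<mu>01 by (intro mult_right_mono power_le_one) auto
    then show ?thesis using it[OF x, of n] x by simp
  qed
  have "ball 0 \<delta> \<subseteq> basin"
  proof
    fix x :: "complex^'n" assume x: "x \<in> ball 0 \<delta>"
    have "(\<lambda>n. (F ^^ n) x) \<longlonglongrightarrow> 0"
    proof (rule Lim_null_comparison)
      show "\<forall>\<^sub>F n in sequentially. norm ((F ^^ n) x) \<le> \<mu> ^ n * norm x" using it[OF x] by simp
      show "(\<lambda>n. \<mu> ^ n * norm x) \<longlonglongrightarrow> 0"
        using \<mu>01 by (auto intro!: tendsto_mult_left_zero LIMSEQ_power_zero)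
    qed
    then show "x \<in> basin" by (simp add: basin_def)
  qed
  moreover have "uniform_limit (ball 0 \<delta>) (\<lambda>n x. (1 / \<kappa> ^ n) *\<^sub>R (F ^^ n) x) koenigs sequentially"
  proof -
    let ?\<psi> = "\<lambda>n x. (1 / \<kappa> ^ n) *\<^sub>R (F ^^ n) x"
    let ?M = "\<lambda>n. C * \<delta>\<^sup>2 / \<kappa> * (\<mu>\<^sup>2 / \<kappa>) ^ n"
    let ?s = "\<lambda>x. suminf (\<lambda>i. ?\<psi> (Suc i) x - ?\<psi> i x)"
    have step: "norm (?\<psi> (Suc n) x - ?\<psi> n x) \<le> ?M n" if x: "x \<in> ball 0 \<delta>" for n x
    proof -
      let ?y = "(F ^^ n) x"
      have "?\<psi> (Suc n) x - ?\<psi> n x = (1 / \<kappa> ^ Suc n) *\<^sub>R (F ?y - \<kappa> *\<^sub>R ?y)"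
        using \<kappa> by (simp add: scaleR_diff_right)
      then have "norm (?\<psi> (Suc n) x - ?\<psi> n x) = (1 / \<kappa> ^ Suc n) * norm (F ?y - \<kappa> *\<^sub>R ?y)"
        using \<kappa> by (simp add: norm_power)
      also have "\<dots> \<le> (1 / \<kappa> ^ Suc n) * (C * (norm ?y)\<^sup>2)"
        using C(3)[of ?y] inb[OF x, of n] \<kappa> by (intro mult_left_mono) (auto simp: \<delta>_def)
      also have "\<dots> \<le> (1 / \<kappa> ^ Suc n) * (C * (\<mu> ^ n * \<delta>)\<^sup>2)"
      proof (intro mult_left_mono power_mono)
        show "norm ?y \<le> \<mu> ^ n * \<delta>"
          by (rule order_trans[OF it[OF x]], rule mult_left_mono) (use x \<mu>01 in auto)
      qed (use \<kappa> C in auto)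
      also have "\<dots> = ?M n"
        by (simp add: power_mult_distrib power_divide power_mult[symmetric] mult.commute)
      finally show ?thesis .
    qed
    have telescope: "(\<Sum>i<n. ?\<psi> (Suc i) x - ?\<psi> i x) = ?\<psi> n x - ?\<psi> 0 x" for n x
      by (rule sum_lessThan_telescope)
    have "uniform_limit (ball 0 \<delta>) (\<lambda>n x. \<Sum>i<n. ?\<psi> (Suc i) x - ?\<psi> i x) ?s sequentially"
    proof (rule Weierstrass_m_test[OF step])
      show "summable ?M" using \<mu>2 \<kappa> by (intro summable_mult summable_geometric) auto
    qed
    then have "uniform_limit (ball 0 \<delta>) (\<lambda>n x. ?\<psi> n x - ?\<psi> 0 x) ?s sequentially"
      unfolding telescope .
    from uniform_limit_add[OF this uniform_limit_const[where c = "\<lambda>x. x"]]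
    have ul: "uniform_limit (ball 0 \<delta>) ?\<psi> (\<lambda>x. ?s x + x) sequentially" by simp
    have "koenigs x = ?s x + x" if "x \<in> ball 0 \<delta>" for x
      unfolding koenigs_def by (rule limI[OF tendsto_uniform_limitI[OF ul that]])
    then show ?thesis using ul uniform_limit_cong'[of "ball 0 \<delta>" ?\<psi> ?\<psi> koenigs "\<lambda>x. ?s x + x"] by blast
  qed
  ultimately show ?thesis using that \<delta> by blast
qed

section \<open>Global linearisation on the basin\<close>

lemma funpow_inverse: "(G ^^ n) ((F ^^ n) x) = x" "(F ^^ n) ((G ^^ n) x) = x"
  by (rule funpow_left_inverse, rule GF FG)+

lemma funpow_mem_basin_iff: "(F ^^ N) z \<in> basin \<longleftrightarrow> z \<in> basin"
proof -
  have "(\<lambda>n. (F ^^ n) ((F ^^ N) z)) = (\<lambda>n. (F ^^ (n + N)) z)" by (simp add: funpow_add)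
  then show ?thesis unfolding basin_def using LIMSEQ_ignore_initial_segment[of "\<lambda>n. (F ^^ n) z" 0 N]
      LIMSEQ_offset[of "\<lambda>n. (F ^^ n) z" N 0] by auto
qed

theorem basin_biholomorphic: "open basin" "\<exists>\<psi> \<Phi>. biholomorphism basin UNIV \<psi> \<Phi>"
proof -
  obtain \<delta> where \<delta>: "\<delta> > 0" "ball 0 \<delta> \<subseteq> basin" and
    ul: "uniform_limit (ball 0 \<delta>) (\<lambda>n x. (1 / \<kappa> ^ n) *\<^sub>R (F ^^ n) x) koenigs sequentially"
    using koenigs_local by blast
  have holF: "holo_map UNIV (F ^^ n)" "holo_map UNIV (G ^^ n)" for n
    by (intro holo_map_funpow F G)+
  have enter: "\<exists>N. \<forall>n\<ge>N. (F ^^ n) z \<in> W" if "z \<in> basin" "open W" "0 \<in> W" for z W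
    using that topological_tendstoD[of "\<lambda>n. (F ^^ n) z" 0 sequentially W]
    by (auto simp: basin_def eventually_sequentially)
  have enter_ball: "\<exists>N. \<forall>n\<ge>N. (F ^^ n) z \<in> ball 0 \<delta>" if "z \<in> basin" for z
    using enter[OF that open_ball[of 0 \<delta>]] \<delta>(1) by simp
  have preim_open: "open ((F ^^ n) -` W)" if "open W" for n W
    by (rule open_vimage[OF that holo_map_continuous_on[OF holF(1)]])
  have "basin = (\<Union>N. (F ^^ N) -` ball 0 \<delta>)"
  proof (intro equalityI subsetI)
    fix z assume "z \<in> basin"
    from enter_ball[OF this] obtain N where "(F ^^ N) z \<in> ball 0 \<delta>" by (meson order_refl)
    then show "z \<in> (\<Union>N. (F ^^ N) -` ball 0 \<delta>)" by (intro UN_I[of N] vimageI2 UNIV_I)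
  next
    fix z assume "z \<in> (\<Union>N. (F ^^ N) -` ball 0 \<delta>)"
    then obtain N where "(F ^^ N) z \<in> ball 0 \<delta>" by (elim UN_E vimageE) auto
    then show "z \<in> basin" using \<delta>(2) funpow_mem_basin_iff[of N z] by blast
  qed
  then show "open basin" using preim_open[OF open_ball] by auto
  let ?\<psi> = "\<lambda>n x. (1 / \<kappa> ^ n) *\<^sub>R (F ^^ n) x"
  have hol\<psi>n: "holo_map (ball 0 \<delta>) (?\<psi> n)" for n
    using holo_map_compose[OF holo_map_mono[OF holF(1) subset_UNIV] holo_map_scaleR_add[of _ _ 0] subset_UNIV]
    by simp
  note hol\<psi> = holo_map_uniform_limit[OF hol\<psi>n ul]
  \<comment> \<open>Convergence is known only on the small ball. The shift expresses
    \<open>koenigs\<close> near any basin point through an iterate that has entered the ball, which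
    spreads holomorphy over the whole basin.\<close>
  have \<psi>_shift: "koenigs z = (1 / \<kappa> ^ N) *\<^sub>R koenigs ((F ^^ N) z)" if "(F ^^ N) z \<in> ball 0 \<delta>" for z N
  proof -
    have "(\<lambda>n. (1 / \<kappa> ^ N) *\<^sub>R ?\<psi> n ((F ^^ N) z)) \<longlonglongrightarrow> (1 / \<kappa> ^ N) *\<^sub>R koenigs ((F ^^ N) z)"
      by (intro tendsto_intros tendsto_uniform_limitI[OF ul that])
    also have "(\<lambda>n. (1 / \<kappa> ^ N) *\<^sub>R ?\<psi> n ((F ^^ N) z)) = (\<lambda>n. ?\<psi> (n + N) z)"
      by (simp add: funpow_add power_add mult.commute)
    finally have "(\<lambda>n. ?\<psi> n z) \<longlonglongrightarrow> (1 / \<kappa> ^ N) *\<^sub>R koenigs ((F ^^ N) z)"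
      by (rule LIMSEQ_offset)
    then show ?thesis unfolding koenigs_def[of z] by (rule limI)
  qed
  have \<psi>_F: "koenigs ((F ^^ n) z) = \<kappa> ^ n *\<^sub>R koenigs z" if z: "z \<in> basin" for z n
  proof -
    obtain N where N: "\<And>m. m \<ge> N \<Longrightarrow> (F ^^ m) z \<in> ball 0 \<delta>" using enter_ball[OF z] by blast
    have "koenigs z = (1 / \<kappa> ^ (N + n)) *\<^sub>R koenigs ((F ^^ (N + n)) z)" by (rule \<psi>_shift[OF N]) simp
    moreover have "koenigs ((F ^^ n) z) = (1 / \<kappa> ^ N) *\<^sub>R koenigs ((F ^^ (N + n)) z)"
      using \<psi>_shift[of N "(F ^^ n) z"] N[of "N + n"] by (simp add: funpow_add)
    ultimately show ?thesis using \<kappa> by (simp add: power_add)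
  qed
  have hol: "holo_map basin koenigs" unfolding holo_map_def
  proof
    fix z assume "z \<in> basin"
    then obtain N where N: "(F ^^ N) z \<in> ball 0 \<delta>" using enter_ball by (meson order_refl)
    let ?W = "(F ^^ N) -` ball 0 \<delta>"
    have "holo_map ?W (\<lambda>z. (1 / \<kappa> ^ N) *\<^sub>R koenigs ((F ^^ N) z) + 0)"
      by (rule holo_map_compose[OF holo_map_compose[OF holo_map_mono[OF holF(1) subset_UNIV] hol\<psi>(1)]
            holo_map_scaleR_add subset_UNIV]) auto
    then obtain L where L: "((\<lambda>z. (1 / \<kappa> ^ N) *\<^sub>R koenigs ((F ^^ N) z) + 0) has_derivative L) (at z)"
      "\<forall>c v. L (c *s v) = c *s L v" using N unfolding holo_map_def by blast
    have "(koenigs has_derivative L) (at z)"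
      by (rule has_derivative_transform_within_open[OF L(1) preim_open[OF open_ball, of N 0 \<delta>]])
         (use N \<psi>_shift[of N] in auto)
    with L show "\<exists>L. (koenigs has_derivative L) (at z) \<and> (\<forall>c v. L (c *s v) = c *s L v)" by blast
  qed
  have fix0: "(F ^^ n) 0 = 0" for n by (induction n) (auto simp: F0)
  have DFn: "((F ^^ n) has_derivative (\<lambda>h. \<kappa> ^ n *\<^sub>R h)) (at 0)" for n
  proof (induction n)
    case (Suc n)
    have "((\<lambda>x. F ((F ^^ n) x)) has_derivative (\<lambda>h. \<kappa> *\<^sub>R (\<kappa> ^ n *\<^sub>R h))) (at 0)"
      by (rule has_derivative_compose[OF Suc]) (simp add: fix0 DF0)
    then show ?case by (simp add: o_def)
  qed (simp add: id_def)
  have D0: "frechet_derivative koenigs (at 0) = (\<lambda>v. v)"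
  proof
    fix v
    have "(?\<psi> n has_derivative (\<lambda>h. (1 / \<kappa> ^ n) *\<^sub>R (\<kappa> ^ n *\<^sub>R h))) (at 0)" for n
      by (intro has_derivative_scaleR_right DFn)
    then have "frechet_derivative (?\<psi> n) (at 0) = (\<lambda>v. v)" for n
      using frechet_derivative_at[of "?\<psi> n" "\<lambda>v. v" 0] \<kappa> by (simp add: power_not_zero)
    then have "(\<lambda>n. v) \<longlonglongrightarrow> frechet_derivative koenigs (at 0) v"
      using hol\<psi>(2)[of 0 v] \<delta> by simp
    then show "frechet_derivative koenigs (at 0) v = v" by (simp add: LIMSEQ_const_iff)
  qed
  have \<psi>0: "koenigs 0 = 0" by (simp add: koenigs_def fix0)
  obtain U' V g where loc: "open U'" "U' \<subseteq> ball 0 \<delta>" "0 \<in> U'" "open V" "0 \<in> V"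
    "homeomorphism U' V koenigs g" "holo_map V g"
    using holo_map_local_inverse[OF hol\<psi>(1) open_ball _ D0] \<delta> \<psi>0 by (metis centre_in_ball)
  \<comment> \<open>Two points with equal image are iterated until both lie in \<open>U'\<close>,
    where \<open>koenigs\<close> is injective; applying \<open>G\<close> equally often returns to
    the original points.\<close>
  have inj: "inj_on koenigs basin"
  proof (rule inj_onI)
    fix z w assume zw: "z \<in> basin" "w \<in> basin" "koenigs z = koenigs w"
    obtain N where N: "\<And>m. m \<ge> N \<Longrightarrow> (F ^^ m) z \<in> U'" using enter[OF zw(1) loc(1,3)] by auto
    obtain M where M: "\<And>m. m \<ge> M \<Longrightarrow> (F ^^ m) w \<in> U'" using enter[OF zw(2) loc(1,3)] by auto
    have "koenigs ((F ^^ (N + M)) z) = koenigs ((F ^^ (N + M)) w)" using \<psi>_F[OF zw(1)] \<psi>_F[OF zw(2)] zw(3) by simp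
    then have "(F ^^ (N + M)) z = (F ^^ (N + M)) w"
      using N[of "N + M"] M[of "N + M"] homeomorphism_apply1[OF loc(6)] by (metis le_add1 le_add2)
    then have "(G ^^ (N + M)) ((F ^^ (N + M)) z) = (G ^^ (N + M)) ((F ^^ (N + M)) w)" by simp
    then show "z = w" unfolding funpow_inverse .
  qed
  define \<Phi> where "\<Phi> = inv_into basin koenigs"
  \<comment> \<open>Surjectivity: contract \<open>w\<close> into \<open>V\<close>, invert locally by
    \<open>g\<close>, and expand again by \<open>G ^^ n\<close>. As \<open>V\<close> is open, one
    \<open>n\<close> serves a whole neighbourhood of \<open>w\<close>, so the same formula shows
    that \<open>\<Phi>\<close> is holomorphic.\<close>
  have \<Phi>_eq: "(G ^^ n) (g (\<kappa> ^ n *\<^sub>R w)) \<in> basin \<and> koenigs ((G ^^ n) (g (\<kappa> ^ n *\<^sub>R w))) = w"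
    if "\<kappa> ^ n *\<^sub>R w \<in> V" for n w
  proof
    let ?y = "g (\<kappa> ^ n *\<^sub>R w)"
    have y: "?y \<in> U'" "koenigs ?y = \<kappa> ^ n *\<^sub>R w" using that loc(6) by (auto simp: homeomorphism_def)
    then have "?y \<in> basin" using loc(2) \<delta> by blast
    then show b: "(G ^^ n) ?y \<in> basin"
      using funpow_mem_basin_iff[of n "(G ^^ n) ?y"] funpow_inverse(2) by simp
    show "koenigs ((G ^^ n) ?y) = w"
      using \<psi>_F[OF b, of n] y(2) \<kappa> by (simp add: funpow_inverse(2))
  qed
  have reach: "\<exists>n. \<kappa> ^ n *\<^sub>R w \<in> V" for w
  proof -
    have "(\<lambda>n. \<kappa> ^ n *\<^sub>R w) \<longlonglongrightarrow> 0 *\<^sub>R w" using \<kappa> by (intro tendsto_intros LIMSEQ_power_zero) auto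
    then show ?thesis using topological_tendstoD[of _ 0 sequentially V] loc(4,5)
      by (auto simp: eventually_sequentially)
  qed
  have surj: "koenigs ` basin = UNIV" using \<Phi>_eq reach by (metis UNIV_eq_I imageI)
  have hol\<Phi>: "holo_map UNIV \<Phi>" unfolding holo_map_def
  proof
    fix w
    obtain n where n: "\<kappa> ^ n *\<^sub>R w \<in> V" using reach by blast
    let ?W = "(\<lambda>w. \<kappa> ^ n *\<^sub>R w + 0) -` V"
    have wW: "w \<in> ?W" using n by simp
    have "holo_map ?W (\<lambda>w. (G ^^ n) (g (\<kappa> ^ n *\<^sub>R w + 0)))"
      by (rule holo_map_compose[OF holo_map_compose[OF holo_map_scaleR_add loc(7)] holF(2) subset_UNIV]) auto
    then obtain L where L: "((\<lambda>w. (G ^^ n) (g (\<kappa> ^ n *\<^sub>R w + 0))) has_derivative L) (at w)"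
      "\<forall>c v. L (c *s v) = c *s L v" using wW unfolding holo_map_def by blast
    have oW: "open ?W"
      by (intro open_vimage loc(4) continuous_intros)
    have "(\<Phi> has_derivative L) (at w)"
    proof (rule has_derivative_transform_within_open[OF L(1) oW])
      show "(G ^^ n) (g (\<kappa> ^ n *\<^sub>R x + 0)) = \<Phi> x" if "x \<in> ?W" for x
        using \<Phi>_eq[of n x] that inv_into_f_f[OF inj] unfolding \<Phi>_def by force
    qed (use n in simp)
    with L show "\<exists>L. (\<Phi> has_derivative L) (at w) \<and> (\<forall>c v. L (c *s v) = c *s L v)" by blast
  qed
  have "biholomorphism basin UNIV koenigs \<Phi>"
    unfolding biholomorphism_def \<Phi>_def[symmetric]
  proof (intro conjI hol hol\<Phi> surj ballI)
    show "\<Phi> ` UNIV = basin" unfolding \<Phi>_def using inj surj by (metis inv_into_image_cancel order_refl)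
    show "\<Phi> (koenigs x) = x" if "x \<in> basin" for x using that inj unfolding \<Phi>_def by simp
    show "koenigs (\<Phi> y) = y" for y unfolding \<Phi>_def using surj by (simp add: f_inv_into_f)
  qed
  then show "\<exists>\<psi> \<Phi>. biholomorphism basin UNIV \<psi> \<Phi>" by blast
qed

end

section \<open>Overshears fixing a variety of codimension two\<close>

lemma has_derivative_vec_componentwise:
  fixes f :: "'a::real_normed_vector \<Rightarrow> complex^'m"
  assumes "\<And>i. ((\<lambda>x. f x $ i) has_derivative (\<lambda>h. L h $ i)) (at x)"
  shows "(f has_derivative L) (at x)"
proof -
  have *: "(v::complex^'m) = (\<Sum>i\<in>UNIV. (v $ i) *s axis i 1)" for v
    by (simp add: vec_eq_iff axis_def if_distrib cong: if_cong)
  have "((\<lambda>x. \<Sum>i\<in>UNIV. (f x $ i) *s axis i 1) has_derivative (\<lambda>h. \<Sum>i\<in>UNIV. (L h $ i) *s axis i 1)) (at x)"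
    by (intro has_derivative_sum bounded_linear.has_derivative[OF bounded_linear_cscale_left] assms)
  then show ?thesis by (simp flip: *)
qed

text \<open>The scalar counterpart of \<open>holo_map UNIV\<close>, whose values must be vectors; it
  lets maps be checked one component at a time.\<close>

definition entire :: "(complex^'n \<Rightarrow> complex) \<Rightarrow> bool" where
  "entire f \<longleftrightarrow> (\<forall>x. \<exists>L. (f has_derivative L) (at x) \<and> (\<forall>c v. L (c *s v) = c * L v))"

lemma holo_map_componentwise:
  fixes f :: "complex^'n \<Rightarrow> complex^'m"
  assumes "\<And>i. entire (\<lambda>x. f x $ i)"
  shows "holo_map UNIV f"
  unfolding holo_map_def
proof
  fix x
  have "\<forall>i. \<exists>L. ((\<lambda>x. f x $ i) has_derivative L) (at x) \<and> (\<forall>c v. L (c *s v) = c * L v)"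
    using assms unfolding entire_def by blast
  from choice[OF this] obtain L where L: "\<And>i. ((\<lambda>x. f x $ i) has_derivative L i) (at x)"
    "\<And>i c v. L i (c *s v) = c * L i v" by blast
  have "(f has_derivative (\<lambda>h. \<chi> i. L i h)) (at x)"
    by (rule has_derivative_vec_componentwise) (simp add: L)
  moreover have "\<forall>c v. (\<chi> i. L i (c *s v)) = c *s (\<chi> i. L i v)" by (simp add: L vec_eq_iff)
  ultimately show "\<exists>L. (f has_derivative L) (at x) \<and> (\<forall>c v. L (c *s v) = c *s L v)" by blast
qed

lemma entire_const: "entire (\<lambda>x. c)"
  unfolding entire_def by (auto intro!: exI[of _ "\<lambda>h. 0"])

lemma entire_nth: "entire (\<lambda>x. x $ i)"
  unfolding entire_def
  by (auto intro!: exI[of _ "\<lambda>h. h $ i"] bounded_linear.has_derivative[OF bounded_linear_vec_nth] has_derivative_ident)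

lemma entire_add:
  assumes "entire f" "entire g" shows "entire (\<lambda>x. f x + g x)"
  unfolding entire_def
proof
  fix x
  obtain L M where "(f has_derivative L) (at x)" "(g has_derivative M) (at x)"
    and *: "\<And>c v. L (c *s v) = c * L v" "\<And>c v. M (c *s v) = c * M v"
    using assms unfolding entire_def by metis
  then have "((\<lambda>x. f x + g x) has_derivative (\<lambda>h. L h + M h)) (at x)" by (intro has_derivative_add)
  moreover have "\<forall>c v. L (c *s v) + M (c *s v) = c * (L v + M v)" by (simp add: * distrib_left)
  ultimately show "\<exists>L. ((\<lambda>x. f x + g x) has_derivative L) (at x) \<and> (\<forall>c v. L (c *s v) = c * L v)" by blast
qed

lemma entire_mult:
  assumes "entire f" "entire g" shows "entire (\<lambda>x. f x * g x)"
  unfolding entire_def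
proof
  fix x
  obtain L M where "(f has_derivative L) (at x)" "(g has_derivative M) (at x)"
    and *: "\<And>c v. L (c *s v) = c * L v" "\<And>c v. M (c *s v) = c * M v"
    using assms unfolding entire_def by metis
  then have "((\<lambda>x. f x * g x) has_derivative (\<lambda>h. f x * M h + L h * g x)) (at x)" by (intro has_derivative_mult)
  moreover have "\<forall>c v. f x * M (c *s v) + L (c *s v) * g x = c * (f x * M v + L v * g x)"
    by (simp add: * algebra_simps)
  ultimately show "\<exists>L. ((\<lambda>x. f x * g x) has_derivative L) (at x) \<and> (\<forall>c v. L (c *s v) = c * L v)" by blast
qed

lemma entire_exp:
  assumes "entire f" shows "entire (\<lambda>x. exp (f x))"
  unfolding entire_def
proof
  fix x
  obtain L where L: "(f has_derivative L) (at x)" and *: "\<And>c v. L (c *s v) = c * L v"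
    using assms unfolding entire_def by metis
  have "((\<lambda>x. exp (f x)) has_derivative (\<lambda>h. exp (f x) * L h)) (at x)"
    by (rule has_derivative_compose[OF L]) (use DERIV_exp has_field_derivative_def in blast)
  moreover have "\<forall>c v. exp (f x) * L (c *s v) = c * (exp (f x) * L v)"
    by (simp add: * algebra_simps)
  ultimately show "\<exists>L. ((\<lambda>x. exp (f x)) has_derivative L) (at x) \<and> (\<forall>c v. L (c *s v) = c * L v)" by blast
qed

lemma entire_translate:
  assumes "entire f" shows "entire (\<lambda>x. f (q + x))"
  unfolding entire_def
proof
  fix x
  obtain L where L: "(f has_derivative L) (at (q + x))" and *: "\<And>c v. L (c *s v) = c * L v"
    using assms unfolding entire_def by metis
  have "((\<lambda>x. q + x) has_derivative (\<lambda>h. h)) (at x)" by (auto intro!: derivative_eq_intros)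
  from has_derivative_compose[OF this L] *
  show "\<exists>L. ((\<lambda>x. f (q + x)) has_derivative L) (at x) \<and> (\<forall>c v. L (c *s v) = c * L v)" by blast
qed

lemma entire_cpoly: "p \<in> cpoly \<Longrightarrow> entire p"
  by (induction rule: cpoly.induct) (auto intro: entire_const entire_nth entire_add entire_mult)

lemma cpoly_on_line:
  assumes "p \<in> cpoly"
  shows "\<exists>P. \<forall>t. p (a + t *s b) = poly P t"
  using assms
proof (induction rule: cpoly.induct)
  case (const c)
  show ?case by (rule exI[of _ "[:c:]"]) simp
next
  case (coord i)
  show ?case by (rule exI[of _ "[:a $ i, b $ i:]"]) simp
next
  case (add p q)
  then show ?case by (metis poly_add)
next
  case (mult p q)
  then show ?case by (metis poly_mult)
qed

text \<open>In the induction step a complex line joins a point that is good for \<open>I\<close>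
  (parameter 0) to a point where \<open>p j\<close> is nonzero (parameter 1). Every polynomial
  restricts to a nonzero polynomial on this line, so all parameters but finitely many work.\<close>

lemma cpoly_common_nonzero:
  fixes p :: "'i \<Rightarrow> complex^'n \<Rightarrow> complex"
  assumes "finite I" "\<And>i. i \<in> I \<Longrightarrow> p i \<in> cpoly" "\<And>i. i \<in> I \<Longrightarrow> \<exists>x. p i x \<noteq> 0"
  shows "\<exists>q. \<forall>i\<in>I. p i q \<noteq> 0"
  using assms
proof (induction I rule: finite_induct)
  case (insert j I)
  then obtain q0 where q0: "\<forall>i\<in>I. p i q0 \<noteq> 0" by auto
  obtain x where x: "p j x \<noteq> 0" using insert.prems by auto
  have "\<exists>P. \<forall>t. p i (q0 + t *s (x - q0)) = poly P t" if "i \<in> insert j I" for i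
    using cpoly_on_line insert.prems(1)[OF that] by blast
  then obtain P where P: "\<And>i t. i \<in> insert j I \<Longrightarrow> p i (q0 + t *s (x - q0)) = poly (P i) t" by metis
  have nz: "P i \<noteq> 0" if "i \<in> insert j I" for i
  proof (cases "i = j")
    case True
    then have "poly (P i) 1 \<noteq> 0" using P[of i 1] x by simp
    then show ?thesis by auto
  next
    case False
    then have "poly (P i) 0 \<noteq> 0" using P[of i 0] q0 that by (metis add.right_neutral insertE vector_smult_lzero)
    then show ?thesis by auto
  qed
  have "finite (\<Union>i\<in>insert j I. {t. poly (P i) t = 0})"
    using insert.hyps nz by (intro finite_UN_I poly_roots_finite) auto
  then obtain t where "t \<notin> (\<Union>i\<in>insert j I. {t. poly (P i) t = 0})"
    using ex_new_if_finite[OF infinite_UNIV_char_0] by blast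
  then have "\<forall>i\<in>insert j I. p i (q0 + t *s (x - q0)) \<noteq> 0" using P by auto
  then show ?case by blast
qed simp

section \<open>Overshears and their compositions\<close>

definition overshear :: "'n \<Rightarrow> (complex^'n \<Rightarrow> complex) \<Rightarrow> complex^'n \<Rightarrow> complex^'n" where
  "overshear i g z = (\<chi> l. if l = i then z $ i * exp (g z) else z $ l)"

lemma overshear_nth: "overshear i g z $ l = (if l = i then z $ i * exp (g z) else z $ l)"
  by (simp add: overshear_def)

lemma holo_map_overshear:
  assumes "entire g"
  shows "holo_map UNIV (overshear i g)"
proof (rule holo_map_componentwise)
  show "entire (\<lambda>x. overshear i g x $ l)" for l
    unfolding overshear_nth
    by (cases "l = i") (simp_all add: entire_mult[OF entire_nth entire_exp[OF assms]] entire_nth)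
qed

text \<open>Only coordinate \<open>i\<close> changes and \<open>g\<close> does not see it, so the
  exponential factor is the same before and after and can be divided out.\<close>

lemma overshear_inverse:
  assumes "\<And>x y. (\<And>l. l \<noteq> i \<Longrightarrow> x $ l = y $ l) \<Longrightarrow> g x = g y"
  shows "overshear i (\<lambda>z. - g z) (overshear i g z) = z"
proof -
  have "g (overshear i g z) = g z" by (rule assms) (simp add: overshear_nth)
  then show ?thesis by (simp add: vec_eq_iff overshear_nth exp_minus)
qed

text \<open>Differentiating the exponential leaves a term with the factor \<open>z $ i\<close>,
  which is 0 at the origin, so the derivative of \<open>g\<close> does not appear.\<close>

lemma overshear_derivative_0:
  assumes "entire g"
  shows "(overshear i g has_derivative (\<lambda>h. \<chi> l. if l = i then h $ i * exp (g 0) else h $ l)) (at 0)"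
proof (rule has_derivative_vec_componentwise)
  fix l
  have nth: "((\<lambda>x::complex^'a. x $ j) has_derivative (\<lambda>h. h $ j)) (at 0)" for j
    by (rule bounded_linear.has_derivative[OF bounded_linear_vec_nth has_derivative_ident])
  obtain M where "((\<lambda>x. exp (g x)) has_derivative M) (at 0)"
    using entire_exp[OF assms] unfolding entire_def by blast
  from has_derivative_mult[OF nth this, of i] nth[of l]
  show "((\<lambda>x. overshear i g x $ l) has_derivative
     (\<lambda>h. (\<chi> l. if l = i then h $ i * exp (g 0) else h $ l) $ l)) (at 0)"
    by (cases "l = i") (simp_all add: overshear_nth)
qed

text \<open>Each overshear halves one coordinate to first order at 0 and is the identity where its
  polynomial vanishes. Induction over the coordinate set makes the derivative one half in every
  direction treated so far.\<close>

lemma overshears_compose: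
  fixes p :: "'n \<Rightarrow> complex^'n \<Rightarrow> complex"
  assumes "finite A"
    and p: "\<And>i. p i \<in> cpoly" and p0: "\<And>i. p i q \<noteq> 0"
    and indep: "\<And>i x y. (\<And>l. l \<noteq> i \<Longrightarrow> x $ l = y $ l) \<Longrightarrow> p i x = p i y"
  shows "\<exists>F G. holo_map UNIV F \<and> holo_map UNIV G \<and> (\<forall>x. G (F x) = x) \<and> (\<forall>x. F (G x) = x) \<and> F 0 = 0 \<and>
    (F has_derivative (\<lambda>h. \<chi> l. if l \<in> A then h $ l / 2 else h $ l)) (at 0) \<and>
    (\<forall>z. (\<forall>i. p i (q + z) = 0) \<longrightarrow> F z = z)"
  using assms(1)
proof (induction A rule: finite_induct)
  case empty
  show ?case by (rule exI[of _ "\<lambda>x. x"], rule exI[of _ "\<lambda>x. x"]) (simp add: holo_map_id has_derivative_ident)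
next
  case (insert i A)
  then obtain F G where FG: "holo_map UNIV F" "holo_map UNIV G" "\<And>x. G (F x) = x" "\<And>x. F (G x) = x" "F 0 = 0"
    and D: "(F has_derivative (\<lambda>h. \<chi> l. if l \<in> A then h $ l / 2 else h $ l)) (at 0)"
    and fixp: "\<And>z. (\<forall>i. p i (q + z) = 0) \<Longrightarrow> F z = z" by blast
  \<comment> \<open>Normalised so that \<open>g 0 = - ln 2\<close>, that is, a factor one half at
    the origin; \<open>p i q \<noteq> 0\<close> makes this possible.\<close>
  define c where "c = - of_real (ln 2) / p i q"
  define g where "g = (\<lambda>z. c * p i (q + z))"
  have exp_g0: "exp (g 0) = 1 / 2"
  proof -
    have "exp (g 0) = exp (- of_real (ln 2))" using p0[of i] by (simp add: g_def c_def)
    also have "\<dots> = of_real (exp (- ln 2))" by (metis exp_of_real of_real_minus)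
    finally show ?thesis by (simp add: exp_minus)
  qed
  have eg: "entire g" "entire (\<lambda>z. - g z)"
  proof -
    show "entire g" unfolding g_def by (intro entire_mult entire_const entire_translate entire_cpoly p)
    from entire_mult[OF entire_const[of "-1"] this] show "entire (\<lambda>z. - g z)" by simp
  qed
  have gi: "g x = g y" if "\<And>l. l \<noteq> i \<Longrightarrow> x $ l = y $ l" for x y
    unfolding g_def using indep[of i "q + x" "q + y"] that by simp
  have gi': "- g x = - g y" if "\<And>l. l \<noteq> i \<Longrightarrow> x $ l = y $ l" for x y
    using gi[OF that] by simp
  let ?E = "overshear i g" and ?E' = "overshear i (\<lambda>z. - g z)"
  have E: "?E' (?E z) = z" "?E (?E' z) = z" for z
    using overshear_inverse[of i g z, OF gi] overshear_inverse[of i "\<lambda>z. - g z" z, OF gi'] by simp_all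
  have E0: "?E 0 = 0" by (simp add: vec_eq_iff overshear_nth)
  have "holo_map UNIV (\<lambda>x. ?E (F x))" "holo_map UNIV (\<lambda>x. G (?E' x))"
    by (rule holo_map_compose[OF _ _ subset_UNIV], auto intro: FG holo_map_overshear eg)+
  moreover have "((\<lambda>x. ?E (F x)) has_derivative (\<lambda>h. \<chi> l. if l \<in> insert i A then h $ l / 2 else h $ l)) (at 0)"
  proof -
    have "((\<lambda>x. ?E (F x)) has_derivative (\<lambda>h. \<chi> l. if l = i then (\<chi> l. if l \<in> A then h $ l / 2 else h $ l) $ i * exp (g 0)
        else (\<chi> l. if l \<in> A then h $ l / 2 else h $ l) $ l)) (at 0)"
      by (rule has_derivative_compose[OF D]) (use overshear_derivative_0[OF eg(1)] FG(5) in simp)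
    also have "(\<lambda>h::complex^'n. \<chi> l. if l = i then (\<chi> l. if l \<in> A then h $ l / 2 else h $ l) $ i * exp (g 0)
        else (\<chi> l. if l \<in> A then h $ l / 2 else h $ l) $ l) = (\<lambda>h. \<chi> l. if l \<in> insert i A then h $ l / 2 else h $ l)"
      using insert.hyps exp_g0 by (auto simp: fun_eq_iff vec_eq_iff)
    finally show ?thesis .
  qed
  moreover have "?E (F z) = z" if "\<forall>i. p i (q + z) = 0" for z
    unfolding fixp[OF that] using that by (simp add: vec_eq_iff overshear_nth g_def)
  ultimately show ?case
    by (intro exI[of _ "\<lambda>x. ?E (F x)"] exI[of _ "\<lambda>x. G (?E' x)"]) (simp add: FG E E0)
qed

lemma automorphism_fixing_variety:
  fixes V :: "(complex^'n) set"
  assumes "CARD('n) \<ge> 2" "has_alg_dim V (CARD('n) - 2)"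
  obtains q F G where "attracting_automorphism F G (1/2)" "q \<notin> V" "\<And>z. q + z \<in> V \<Longrightarrow> F z = z"
proof -
  have "\<exists>p\<in>cpoly. (\<forall>x y. (\<forall>l\<in>UNIV - {i}. x $ l = y $ l) \<longrightarrow> p x = p y) \<and> (\<forall>x\<in>V. p x = 0) \<and> (\<exists>x. p x \<noteq> 0)" for i
  proof -
    have "card (UNIV - {i}) = CARD('n) - 1" by (simp add: card_Diff_singleton)
    \<comment> \<open>\<open>CARD('n) - 1\<close> exceeds the dimension \<open>CARD('n) - 2\<close>;
      with truncated subtraction this is where \<open>CARD('n) \<ge> 2\<close> matters.\<close>
    then have "\<not> coords_indep_on (UNIV - {i}) V"
      using assms unfolding has_alg_dim_def by (metis Suc_1 Suc_diff_Suc Suc_le_lessD diff_Suc_1 lessI not_less One_nat_def)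
    then show ?thesis unfolding coords_indep_on_def by blast
  qed
  then obtain p where p: "\<And>i. p i \<in> cpoly" "\<And>i x y. (\<forall>l\<in>UNIV - {i}. x $ l = y $ l) \<Longrightarrow> p i x = p i y"
    "\<And>i x. x \<in> V \<Longrightarrow> p i x = 0" "\<And>i. \<exists>x. p i x \<noteq> 0" by metis
  obtain q where q: "\<And>i. p i q \<noteq> 0"
    using cpoly_common_nonzero[of UNIV p] p(1,4) by auto
  have indep: "p i x = p i y" if "\<And>l. l \<noteq> i \<Longrightarrow> x $ l = y $ l" for i x y
    by (rule p(2)) (use that in auto)
  obtain F G where FG: "holo_map UNIV F" "holo_map UNIV G" "\<And>x. G (F x) = x" "\<And>x. F (G x) = x" "F 0 = 0"
    and D: "(F has_derivative (\<lambda>h. \<chi> l. if l \<in> UNIV then h $ l / 2 else h $ l)) (at 0)"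
    and fixp: "\<And>z. (\<forall>i. p i (q + z) = 0) \<Longrightarrow> F z = z"
    using overshears_compose[of UNIV p q, OF _ p(1) q indep] by auto
  have "(\<lambda>h::complex^'n. \<chi> l. if l \<in> UNIV then h $ l / 2 else h $ l) = (\<lambda>h. (1/2) *\<^sub>R h)"
    unfolding fun_eq_iff vec_eq_iff vector_scaleR_component by (simp add: scaleR_conv_of_real)
  with D have "attracting_automorphism F G (1/2)"
    by unfold_locales (use FG in auto)
  then show ?thesis using that[of F G q] q p(3) fixp by blast
qed

section \<open>Plurisubharmonicity of the Green function\<close>

definition holo_curve :: "complex set \<Rightarrow> (complex \<Rightarrow> complex^'n) \<Rightarrow> bool" where
  "holo_curve U \<phi> \<longleftrightarrow> (\<forall>t\<in>U. \<exists>w. (\<phi> has_derivative (\<lambda>h. h *s w)) (at t))"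

lemma holo_curve_continuous_on: "holo_curve U \<phi> \<Longrightarrow> continuous_on U \<phi>"
  unfolding holo_curve_def
  by (intro continuous_at_imp_continuous_on ballI) (blast intro: has_derivative_continuous)

lemma holo_curve_component: "holo_curve U \<phi> \<Longrightarrow> (\<lambda>t. \<phi> t $ i) holomorphic_on U"
  unfolding holo_curve_def field_differentiable_def[abs_def] holomorphic_on_def
  by (blast intro: curve_component_field_derivative DERIV_subset)

text \<open>
  The supporting function reduces the maximum principle for \<open>log max 1 |\<phi>|\<close> to the maximum modulus
  principle for a scalar function.
\<close>
lemma holo_curve_supporting_function:
  fixes \<phi> :: "complex \<Rightarrow> complex^'n"
  assumes "holo_curve U \<phi>"
  obtains \<psi> where "\<psi> holomorphic_on U" "\<And>t. norm (\<psi> t) \<le> max 1 (norm (\<phi> t))"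
    "norm (\<psi> z) = max 1 (norm (\<phi> z))"
proof (cases "norm (\<phi> z) \<le> 1")
  case True
  then show ?thesis using that[of "\<lambda>t. 1"] by simp
next
  case False
  let ?N = "norm (\<phi> z)"
  \<comment> \<open>Hermitian pairing with the unit vector in direction \<open>\<phi> z\<close>:
    Cauchy-Schwarz gives the bound, with equality at \<open>z\<close>.\<close>
  let ?\<psi> = "\<lambda>t. (\<Sum>l\<in>UNIV. cnj (\<phi> z $ l) * \<phi> t $ l) / of_real ?N"
  have "?\<psi> holomorphic_on U"
    by (intro holomorphic_intros holo_curve_component[OF assms]) (use False in auto)
  moreover have "norm (?\<psi> t) \<le> max 1 (norm (\<phi> t))" for t
  proof -
    have "norm (\<Sum>l\<in>UNIV. cnj (\<phi> z $ l) * \<phi> t $ l) \<le> (\<Sum>l\<in>UNIV. norm (\<phi> z $ l) * norm (\<phi> t $ l))"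
      by (rule order_trans[OF norm_sum]) (simp add: norm_mult)
    also have "\<dots> \<le> ?N * norm (\<phi> t)"
      using L2_set_mult_ineq[of "\<lambda>l. norm (\<phi> z $ l)" "\<lambda>l. norm (\<phi> t $ l)" UNIV]
      by (simp add: norm_vec_def)
    finally have "norm (?\<psi> t) \<le> norm (\<phi> t)"
      using False by (simp add: norm_divide divide_le_eq mult.commute)
    then show ?thesis by simp
  qed
  moreover have "norm (?\<psi> z) = max 1 (norm (\<phi> z))"
  proof -
    have "(\<Sum>l\<in>UNIV. cnj (\<phi> z $ l) * \<phi> z $ l) = of_real (\<Sum>l\<in>UNIV. (norm (\<phi> z $ l))\<^sup>2)"
      unfolding of_real_sum complex_norm_square by (simp add: mult.commute)
    also have "(\<Sum>l\<in>UNIV. (norm (\<phi> z $ l))\<^sup>2) = ?N\<^sup>2"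
      by (simp add: norm_vec_def L2_set_def sum_nonneg)
    finally show ?thesis using False by (simp add: power2_eq_square)
  qed
  ultimately show ?thesis by (rule that)
qed

section \<open>Maximum principle for logarithms of norms\<close>

text \<open>The exponentiated form of comparing \<open>c * ln (max 1 (norm (\<phi> z)))\<close> with
  a harmonic \<open>h\<close> up to a constant. If the maximum of the product exceeds
  \<open>B\<close>, it is attained only in the interior. Near such a point \<open>h = Re g\<close>,
  and the supporting function times \<open>exp (- g / c)\<close> has a local maximum of its modulus,
  hence is constant, which keeps the product maximal nearby. The set of maximum points is then open,
  closed, nonempty and bounded in the plane, which is impossible. Working in the whole plane avoids
  components of \<open>interior K\<close>.\<close>

lemma harmonic_majorant:
  fixes \<phi> :: "complex \<Rightarrow> complex^'n"
  assumes K: "compact K" and \<phi>: "holo_curve K \<phi>" and h: "continuous_on K h" "harmonic_on (interior K) h"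
    and c: "c > 0" and fr: "\<And>z. z \<in> frontier K \<Longrightarrow> max 1 (norm (\<phi> z)) * exp (- h z / c) \<le> B"
    and z: "z \<in> K"
  shows "max 1 (norm (\<phi> z)) * exp (- h z / c) \<le> B"
proof (rule ccontr)
  let ?Q = "\<lambda>z. max 1 (norm (\<phi> z)) * exp (- h z / c)"
  assume "\<not> ?Q z \<le> B"
  have contQ: "continuous_on K ?Q"
    by (intro continuous_intros holo_curve_continuous_on[OF \<phi>] h) (use c in auto)
  obtain z0 where z0: "z0 \<in> K" "\<And>y. y \<in> K \<Longrightarrow> ?Q y \<le> ?Q z0"
    using continuous_attains_sup[OF K _ contQ] z by blast
  define E where "E = K \<inter> ?Q -` {?Q z0}"
  have "closed E" unfolding E_def
    by (rule continuous_closed_preimage[OF contQ compact_imp_closed[OF K] closed_singleton])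
  moreover have "open E"
  proof (rule openI)
    fix w assume w: "w \<in> E"
    then have Qw: "w \<in> K" "?Q w = ?Q z0" by (auto simp: E_def)
    then have "?Q w > B" using \<open>\<not> ?Q z \<le> B\<close> z0(2)[OF z] by linarith
    then have "w \<notin> frontier K" using fr by force
    then have wi: "w \<in> interior K" using Qw(1) K by (simp add: frontier_def compact_imp_closed)
    then obtain r1 g where r1: "r1 > 0" "g holomorphic_on ball w r1" "\<And>t. t \<in> ball w r1 \<Longrightarrow> h t = Re (g t)"
      using h(2) unfolding harmonic_on_def by blast
    obtain r2 where r2: "r2 > 0" "ball w r2 \<subseteq> interior K"
      using wi open_interior open_contains_ball by blast
    define r where "r = min r1 r2"
    have r: "r > 0" "ball w r \<subseteq> ball w r1" "ball w r \<subseteq> K"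
      using r1 r2 interior_subset[of K] by (auto simp: r_def)
    obtain \<psi> where \<psi>: "\<psi> holomorphic_on K" "\<And>t. norm (\<psi> t) \<le> max 1 (norm (\<phi> t))" "norm (\<psi> w) = max 1 (norm (\<phi> w))"
      using holo_curve_supporting_function[OF \<phi>] by blast
    let ?\<chi> = "\<lambda>t. \<psi> t * exp (- g t / of_real c)"
    have n\<chi>: "norm (?\<chi> t) = norm (\<psi> t) * exp (- h t / c)" if "t \<in> ball w r" for t
      using r1(3)[of t] that r(2) by (simp add: norm_mult subset_iff)
    have le: "norm (?\<chi> t) \<le> ?Q t" if "t \<in> ball w r" for t
      unfolding n\<chi>[OF that] by (intro mult_right_mono \<psi>(2)) simp
    have eq: "norm (?\<chi> w) = ?Q w" using n\<chi>[of w] r(1) \<psi>(3) by simp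
    have "?\<chi> constant_on ball w r"
    proof (rule maximum_modulus_principle[where U = "ball w r" and \<xi> = w])
      show "?\<chi> holomorphic_on ball w r"
        using c by (intro holomorphic_intros holomorphic_on_subset[OF \<psi>(1) r(3)]
            holomorphic_on_subset[OF r1(2) r(2)]) auto
      show "norm (?\<chi> t) \<le> norm (?\<chi> w)" if "t \<in> ball w r" for t
      proof -
        have "t \<in> K" using that r(3) by blast
        from order_trans[OF le[OF that] z0(2)[OF this]] show ?thesis unfolding eq Qw(2) .
      qed
    qed (use r in auto)
    then have const: "?\<chi> t = ?\<chi> w" if "t \<in> ball w r" for t
      using that r(1) unfolding constant_on_def by (metis centre_in_ball)
    have "t \<in> E" if "t \<in> ball w r" for t
    proof -
      have "?Q t \<ge> ?Q z0" using le[OF that] const[OF that] eq Qw(2) by simp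
      then show ?thesis using z0(2)[of t] r(3) that unfolding E_def by force
    qed
    then show "\<exists>e>0. ball w e \<subseteq> E" using r(1) by blast
  qed
  ultimately have "E = {} \<or> E = UNIV" using clopen by blast
  moreover have "z0 \<in> E" using z0 by (simp add: E_def)
  moreover have "bounded E" using compact_imp_bounded[OF K] by (rule bounded_subset) (simp add: E_def)
  ultimately show False using not_bounded_UNIV by (metis empty_iff)
qed

text \<open>Approximants of the Green function. The maximum with 1 produces the positive part of the
  logarithm, and the factor \<open>A\<close> absorbs the constant of the growth bound, so that the
  sequence along an orbit decreases.\<close>

definition log_growth :: "real \<Rightarrow> nat \<Rightarrow> complex^'n \<Rightarrow> real" where
  "log_growth A n w = ln (A * max 1 (norm w)) / 2 ^ n"

lemma usc_on_INF:
  fixes v :: "nat \<Rightarrow> 'a::topological_space \<Rightarrow> real"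
  assumes "\<And>n. continuous_on U (v n)"
  shows "usc_on U (\<lambda>x. INF n. ereal (v n x))"
  unfolding usc_on_def
proof
  fix c :: real
  have *: "{x \<in> U. (INF n. ereal (v n x)) < ereal c} = (\<Union>n. U \<inter> v n -` {..<c})"
    by (auto simp: INF_less_iff)
  have "openin (top_of_set U) (U \<inter> v n -` {..<c})" for n
    by (rule continuous_openin_preimage_gen[OF assms open_lessThan])
  then have "openin (top_of_set U) (\<Union>n. U \<inter> v n -` {..<c})" by (intro openin_Union) auto
  then show "openin (top_of_set U) {x \<in> U. (INF n. ereal (v n x)) < ereal c}" unfolding * .
qed

lemma INF_ereal_less_top: "(INF n. ereal (v n)) < \<infinity>"
  by (rule le_less_trans[OF INF_lower[OF UNIV_I]]) simp

lemma continuous_on_log_growth: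
  assumes "A > 0" "continuous_on U f"
  shows "continuous_on U (\<lambda>x. log_growth A n (f x))"
proof -
  have "A * max 1 (norm (f x)) > 0" for x by (rule mult_pos_pos[OF assms(1)]) simp
  then have "A * max 1 (norm (f x)) \<noteq> 0" for x by (metis less_irrefl)
  then show ?thesis unfolding log_growth_def using assms(2)
    by (intro continuous_intros ballI) auto
qed

text \<open>Rewrites the comparison in the form of \<open>harmonic_majorant\<close>, with
  \<open>c = 1 / 2 ^ n\<close> and \<open>B = 1 / A\<close>.\<close>

lemma log_growth_le_iff:
  assumes "A > 0"
  shows "log_growth A n w \<le> y \<longleftrightarrow> max 1 (norm w) * exp (- y / (1 / 2 ^ n)) \<le> 1 / A"
proof -
  have m: "max 1 (norm w) > 0" by simp
  have "log_growth A n w \<le> y \<longleftrightarrow> ln (A * max 1 (norm w)) \<le> y * 2 ^ n"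
    by (simp add: log_growth_def divide_le_eq)
  also have "\<dots> \<longleftrightarrow> A * max 1 (norm w) \<le> exp (y * 2 ^ n)"
    using assms m by (metis exp_le_cancel_iff exp_ln mult_pos_pos)
  also have "\<dots> \<longleftrightarrow> max 1 (norm w) * exp (- y / (1 / 2 ^ n)) \<le> 1 / A"
    using assms by (simp add: exp_minus field_simps)
  finally show ?thesis .
qed

text \<open>A decreasing limit inherits the maximum principle by a Dini argument: a single index
  already lies below \<open>h + \<epsilon>\<close> on the whole frontier, so the principle for that
  index applies, and then \<open>\<epsilon>\<close> is arbitrary.\<close>

lemma subharmonic_INF_log_growth:
  fixes \<phi> :: "nat \<Rightarrow> complex \<Rightarrow> complex^'n"
  assumes A: "A > 0" and \<phi>: "\<And>n. holo_curve U (\<phi> n)"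
    and dec: "\<And>n t. t \<in> U \<Longrightarrow> log_growth A (Suc n) (\<phi> (Suc n) t) \<le> log_growth A n (\<phi> n t)"
  shows "subharmonic_on U (\<lambda>t. INF n. ereal (log_growth A n (\<phi> n t)))"
proof -
  let ?v = "\<lambda>n t. log_growth A n (\<phi> n t)"
  have cont: "continuous_on U (?v n)" for n
    by (rule continuous_on_log_growth[OF A holo_curve_continuous_on[OF \<phi>]])
  have anti: "?v n t \<le> ?v m t" if "m \<le> n" "t \<in> U" for m n t
    using that(1)
  proof (induction rule: dec_induct)
    case (step n)
    show ?case by (rule order_trans[OF dec[OF that(2)] step.IH])
  qed simp
  have "(INF n. ereal (?v n z)) \<le> ereal (h z)"
    if K: "compact K" "K \<subseteq> U" and h: "continuous_on K h" "harmonic_on (interior K) h"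
      and fr: "\<forall>z\<in>frontier K. (INF n. ereal (?v n z)) \<le> ereal (h z)" and z: "z \<in> K" for K h z
  proof (rule ereal_le_epsilon2)
    fix \<epsilon> :: real assume \<epsilon>: "\<epsilon> > 0"
    have cfr: "compact (frontier K)" and frK: "frontier K \<subseteq> K"
      using K(1) by (simp_all add: compact_imp_closed frontier_subset_closed compact_frontier)
    \<comment> \<open>Bad frontier points at level \<open>n\<close>. These compact sets are nested,
      and a common point would have limit at least \<open>h + \<epsilon>\<close>, so some
      \<open>C n\<close> is empty.\<close>
    define C where "C n = frontier K \<inter> (\<lambda>t. ?v n t - h t) -` {\<epsilon>..}" for n
    have "\<exists>n. C n = {}"
    proof (rule ccontr)
      assume ne: "\<nexists>n. C n = {}"
      have "compact (C n)" for n
      proof -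
        have "continuous_on (frontier K) (\<lambda>t. ?v n t - h t)"
          by (intro continuous_on_diff continuous_on_subset[OF cont] continuous_on_subset[OF h(1)] frK
              order_trans[OF frK K(2)])
        from continuous_closed_preimage[OF this compact_imp_closed[OF cfr] closed_atLeast]
        have "closed (C n)" unfolding C_def .
        from compact_Int_closed[OF cfr this] show ?thesis unfolding C_def by (simp add: Int_absorb flip: Int_assoc)
      qed
      moreover have "C n \<subseteq> C m" if "m \<le> n" for m n
        unfolding C_def using anti[OF that] frK K(2) by force
      ultimately have "\<Inter>(range C) \<noteq> {}" using ne by (intro compact_nest) auto
      then obtain t where t: "\<And>n. t \<in> C n" by auto
      then have tf: "t \<in> frontier K" "\<And>n. h t + \<epsilon> \<le> ?v n t" by (auto simp: C_def algebra_simps)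
      have "ereal (h t + \<epsilon>) \<le> (INF n. ereal (?v n t))" by (rule INF_greatest) (simp add: tf(2))
      also have "\<dots> \<le> ereal (h t)" using fr tf(1) by blast
      finally show False using \<epsilon> by simp
    qed
    then obtain n where n: "C n = {}" by blast
    have hol: "holo_curve K (\<phi> n)" using \<phi>[of n] K(2) unfolding holo_curve_def by blast
    have harm: "harmonic_on (interior K) (\<lambda>t. h t + \<epsilon>)"
      unfolding harmonic_on_def
    proof
      fix w assume "w \<in> interior K"
      then obtain r g where rg: "r > 0" "g holomorphic_on ball w r" "\<forall>t\<in>ball w r. h t = Re (g t)"
        using h(2) unfolding harmonic_on_def by blast
      have "(\<lambda>t. g t + of_real \<epsilon>) holomorphic_on ball w r" using rg(2) by (intro holomorphic_intros)
      moreover have "\<forall>t\<in>ball w r. h t + \<epsilon> = Re (g t + of_real \<epsilon>)" using rg(3) by simp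
      ultimately show "\<exists>r>0. \<exists>g. g holomorphic_on ball w r \<and> (\<forall>t\<in>ball w r. h t + \<epsilon> = Re (g t))"
        using rg(1) by blast
    qed
    have "?v n z \<le> h z + \<epsilon>"
      unfolding log_growth_le_iff[OF A]
    proof (rule harmonic_majorant[OF K(1) hol _ harm _ _ z])
      show "max 1 (norm (\<phi> n t)) * exp (- (h t + \<epsilon>) / (1 / 2 ^ n)) \<le> 1 / A" if "t \<in> frontier K" for t
        unfolding log_growth_le_iff[OF A, symmetric] using n that unfolding C_def by force
    qed (auto intro!: continuous_intros h)
    then have "ereal (?v n z) \<le> ereal (h z) + ereal \<epsilon>" by simp
    then show "(INF n. ereal (?v n z)) \<le> ereal (h z) + ereal \<epsilon>"
      by (rule order_trans[OF INF_lower[OF UNIV_I]])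
  qed
  note maximum_principle = this
  show ?thesis unfolding subharmonic_on_def
    by (intro conjI allI impI ballI usc_on_INF cont INF_ereal_less_top) (rule maximum_principle)
qed

lemma psh_INF_log_growth:
  fixes f :: "nat \<Rightarrow> complex^'n \<Rightarrow> complex^'m"
  assumes A: "A > 0" and f: "\<And>n. holo_map \<Omega> (f n)"
    and dec: "\<And>n x. x \<in> \<Omega> \<Longrightarrow> log_growth A (Suc n) (f (Suc n) x) \<le> log_growth A n (f n x)"
  shows "psh_on \<Omega> (\<lambda>x. INF n. ereal (log_growth A n (f n x)))"
  unfolding psh_on_def
proof (intro conjI ballI allI INF_ereal_less_top)
  show "usc_on \<Omega> (\<lambda>x. INF n. ereal (log_growth A n (f n x)))"
    by (intro usc_on_INF continuous_on_log_growth A holo_map_continuous_on f)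
next
  fix a b
  have "holo_curve {t. a + t *s b \<in> \<Omega>} (\<lambda>t. f n (a + t *s b))" for n
    unfolding holo_curve_def
    using holo_map_along_curve[OF f[of n] _ refl holo_map_frechet(1)[OF f[of n]] has_derivative_complex_line]
    by blast
  then show "subharmonic_on {t. a + t *s b \<in> \<Omega>} (\<lambda>t. INF n. ereal (log_growth A n (f n (a + t *s b))))"
    by (rule subharmonic_INF_log_growth[OF A]) (use dec in auto)
qed

section \<open>Sublevel sets of the Green function\<close>

lemma kobayashi_eq_0:
  assumes "\<And>\<rho>. \<rho> > 0 \<Longrightarrow> \<exists>\<phi>. holo_disc \<phi> \<and> \<phi> ` ball 0 1 \<subseteq> \<Omega> \<and> \<phi> 0 = p \<and>
    (\<phi> has_derivative (\<lambda>h. h *s (\<rho> *\<^sub>R v))) (at 0)"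
  shows "kobayashi \<Omega> p v = 0"
proof -
  let ?X = "{1 / r | r \<phi>. r > 0 \<and> holo_disc \<phi> \<and> \<phi> ` ball 0 1 \<subseteq> \<Omega> \<and>
        \<phi> 0 = p \<and> (\<phi> has_derivative (\<lambda>h. h *s (r *\<^sub>R v))) (at 0)}"
  have mem: "1 / \<rho> \<in> ?X" if "\<rho> > 0" for \<rho> using assms[OF that] that by blast
  have ge: "x \<ge> 0" if "x \<in> ?X" for x using that by auto
  have "Inf ?X \<ge> 0" 
  proof (rule cInf_greatest)
    show "?X \<noteq> {}" using mem[of 1] by (metis empty_iff zero_less_one)
  qed (rule ge)
  moreover have "Inf ?X \<le> 0"
  proof (rule field_le_epsilon)
    fix e :: real assume e: "e > 0"
    have "bdd_below ?X" using ge by (rule bdd_belowI)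
    from cInf_lower[OF mem[of "1 / e"] this] e show "Inf ?X \<le> 0 + e" by simp
  qed
  ultimately show ?thesis unfolding kobayashi_def by simp
qed

text \<open>The growth bound drives the exhaustion and the decreasing approximants;
  \<open>escape\<close> makes the Green function non-constant and the basin proper. The bound 3 on
  the escaping point is \<open>radius 0\<close>, which puts that point in the first sublevel
  set.\<close>

locale quadratic_growth_automorphism =
  fixes F G :: "complex^'n \<Rightarrow> complex^'n" and A :: real
  assumes F: "holo_map UNIV F" and G: "holo_map UNIV G"
    and GF: "G (F x) = x" and FG: "F (G x) = x" and F0: "F 0 = 0"
    and A: "A \<ge> 1" and growth: "norm (F z) \<le> A * (max 1 (norm z))\<^sup>2"
    and escape: "\<exists>z. norm z < 3 \<and> (\<forall>n. 2 ^ (2 ^ n) \<le> norm ((F ^^ n) z))"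
begin

text \<open>
  The radii solve \<open>radius (Suc n) = A (radius n)\<^sup>2\<close>, so that the growth bound makes the sets \<open>sublevel n\<close>
  increase; their union is the set where the Green function is below \<open>ln (3 A)\<close>.
\<close>
definition radius :: "nat \<Rightarrow> real" where
  "radius n = (3 * A) ^ (2 ^ n) / A"

definition sublevel :: "nat \<Rightarrow> (complex^'n) set" where
  "sublevel n = {z. norm ((F ^^ n) z) < radius n}"

lemma funpow_inverse: "(G ^^ n) ((F ^^ n) x) = x" "(F ^^ n) ((G ^^ n) x) = x"
  by (rule funpow_left_inverse, rule GF FG)+

lemma fix0: "(F ^^ n) 0 = 0"
  by (induction n) (auto simp: F0)

lemma radius_gt_1: "radius n > 1"
proof -
  have "(3 * A) ^ 1 \<le> (3 * A) ^ (2 ^ n)" using A by (intro power_increasing) auto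
  then have "3 * A \<le> A * radius n" using A by (simp add: radius_def)
  then show ?thesis using A by simp
qed

lemma A_mult_radius: "A * radius n = (3 * A) ^ (2 ^ n)"
  using A by (simp add: radius_def)

text \<open>\<open>A\<close> times the bound is squared at every step. The start \<open>s\<close> is
  left free so that a value strictly below the critical radius can be inserted.\<close>

lemma growth_iterate:
  assumes "s \<ge> 1" "norm ((F ^^ n) z) \<le> s"
  shows "norm ((F ^^ (n + m)) z) \<le> (A * s) ^ (2 ^ m) / A"
proof (induction m)
  case 0
  then show ?case using assms A by simp
next
  case (Suc m)
  let ?B = "(A * s) ^ (2 ^ m) / A"
  have "1 \<le> A * s" using mult_mono[of 1 A 1 s] A assms by simp
  then have "(A * s) ^ 1 \<le> (A * s) ^ (2 ^ m)" by (intro power_increasing) auto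
  then have "s \<le> ?B" using A by (simp add: field_simps)
  then have B1: "1 \<le> ?B" using assms by linarith
  have "norm ((F ^^ (n + Suc m)) z) \<le> A * (max 1 (norm ((F ^^ (n + m)) z)))\<^sup>2"
    using growth by simp
  also have "\<dots> \<le> A * ?B\<^sup>2"
    using Suc B1 A by (intro mult_left_mono power_mono) auto
  also have "\<dots> = (A * s) ^ (2 ^ Suc m) / A"
    using A by (simp add: power2_eq_square power_add mult_2)
  finally show ?case .
qed

lemma radius_Suc: "radius (Suc n) = A * (radius n)\<^sup>2"
  using A by (simp add: radius_def power2_eq_square power_add mult_2)

lemma sublevel_Suc: "sublevel n \<subseteq> sublevel (Suc n)"
proof
  fix z assume "z \<in> sublevel n"
  then have "max 1 (norm ((F ^^ n) z)) < radius n" using radius_gt_1 by (simp add: sublevel_def)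
  then have "(max 1 (norm ((F ^^ n) z)))\<^sup>2 < (radius n)\<^sup>2" by (intro power_strict_mono) auto
  then have "A * (max 1 (norm ((F ^^ n) z)))\<^sup>2 < radius (Suc n)" unfolding radius_Suc using A by simp
  with growth[of "(F ^^ n) z"] show "z \<in> sublevel (Suc n)" by (simp add: sublevel_def)
qed

text \<open>The growth bound says that \<open>A * max 1 (norm w)\<close> is at most squared by one
  application of \<open>F\<close>, which the doubled denominator compensates.\<close>

lemma log_growth_dec: "log_growth A (Suc n) (F w) \<le> log_growth A n w"
proof -
  let ?m = "max 1 (norm w)"
  have "1 * 1 \<le> A * ?m\<^sup>2" using A by (intro mult_mono one_le_power) auto
  then have "max 1 (norm (F w)) \<le> A * ?m\<^sup>2" using growth[of w] by simp
  then have "A * max 1 (norm (F w)) \<le> A * (A * ?m\<^sup>2)" using A by (intro mult_left_mono) auto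
  moreover have "A * max 1 (norm (F w)) > 0" using A by (intro mult_pos_pos) auto
  ultimately have "ln (A * max 1 (norm (F w))) \<le> ln (A * (A * ?m\<^sup>2))" by (intro ln_mono)
  also have "A * (A * ?m\<^sup>2) = (A * ?m) ^ 2" by (simp add: power2_eq_square)
  also have "ln \<dots> = 2 * ln (A * ?m)" using A by (subst ln_realpow) auto
  finally show ?thesis by (simp add: log_growth_def divide_simps)
qed

section \<open>Images of the sublevel sets under a chart of X\<close>

context
  fixes \<Phi> \<Psi> :: "complex^'n \<Rightarrow> complex^'n" and X :: "(complex^'n) set"
  assumes bih: "biholomorphism UNIV X \<Phi> \<Psi>" and X: "open X"
begin

lemma chart: "holo_map UNIV \<Phi>" "holo_map X \<Psi>" "\<Phi> z \<in> X" "\<Psi> (\<Phi> z) = z" "x \<in> X \<Longrightarrow> \<Phi> (\<Psi> x) = x"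
  using bih unfolding biholomorphism_def by auto

lemma holo_F_chart: "holo_map X (\<lambda>x. (F ^^ n) (\<Psi> x))"
  by (rule holo_map_compose[OF chart(2) holo_map_funpow[OF F] subset_UNIV])

lemma holo_chart_G: "holo_map UNIV (\<lambda>y. \<Phi> ((G ^^ n) y))"
  by (rule holo_map_compose[OF holo_map_funpow[OF G] chart(1) subset_UNIV])

lemma image_sublevel: "\<Phi> ` sublevel n = {x \<in> X. norm ((F ^^ n) (\<Psi> x)) < radius n}"
proof (intro equalityI subsetI)
  fix x assume "x \<in> {x \<in> X. norm ((F ^^ n) (\<Psi> x)) < radius n}"
  then have "x = \<Phi> (\<Psi> x)" "\<Psi> x \<in> sublevel n" by (simp_all add: chart(5) sublevel_def)
  then show "x \<in> \<Phi> ` sublevel n" by (rule image_eqI)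
qed (auto simp: sublevel_def chart(3,4))

lemma open_image_sublevel: "open (\<Phi> ` sublevel n)"
proof -
  have "open (X \<inter> (\<lambda>x. norm ((F ^^ n) (\<Psi> x))) -` {..<radius n})"
    by (intro continuous_open_preimage continuous_on_norm holo_map_continuous_on holo_F_chart X open_lessThan)
  also have "X \<inter> (\<lambda>x. norm ((F ^^ n) (\<Psi> x))) -` {..<radius n} = \<Phi> ` sublevel n"
    unfolding image_sublevel by auto
  finally show ?thesis .
qed

lemma image_sublevel_eq_image_ball:
  "\<Phi> ` sublevel n = (\<lambda>y. \<Phi> ((G ^^ n) (radius n *\<^sub>R y + 0))) ` ball 0 1"
proof (intro equalityI subsetI)
  fix x assume "x \<in> \<Phi> ` sublevel n"
  then have x: "x \<in> X" "norm ((F ^^ n) (\<Psi> x)) < radius n" unfolding image_sublevel by auto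
  let ?y = "(1 / radius n) *\<^sub>R (F ^^ n) (\<Psi> x)"
  have "?y \<in> ball 0 1" using x(2) radius_gt_1[of n] by (simp add: divide_less_eq)
  moreover have "x = \<Phi> ((G ^^ n) (radius n *\<^sub>R ?y + 0))"
    using radius_gt_1[of n] x(1) by (simp add: funpow_inverse chart(5))
  ultimately show "x \<in> (\<lambda>y. \<Phi> ((G ^^ n) (radius n *\<^sub>R y + 0))) ` ball 0 1" by blast
next
  fix x assume "x \<in> (\<lambda>y. \<Phi> ((G ^^ n) (radius n *\<^sub>R y + 0))) ` ball 0 1"
  then obtain y where y: "norm y < 1" "x = \<Phi> ((G ^^ n) (radius n *\<^sub>R y + 0))" by auto
  then have "(G ^^ n) (radius n *\<^sub>R y + 0) \<in> sublevel n"
    using radius_gt_1[of n] mult_strict_left_mono[of "norm y" 1 "radius n"] by (simp add: sublevel_def funpow_inverse)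
  then show "x \<in> \<Phi> ` sublevel n" using y(2) by blast
qed

lemma biholomorphic_image_sublevel: "biholomorphic (\<Phi> ` sublevel n) (ball 0 1)"
proof -
  let ?r = "radius n"
  let ?f = "\<lambda>x. (1 / ?r) *\<^sub>R (F ^^ n) (\<Psi> x) + 0" and ?g = "\<lambda>y. \<Phi> ((G ^^ n) (?r *\<^sub>R y + 0))"
  have r: "?r > 0" using radius_gt_1[of n] by linarith
  have sub: "\<Phi> ` sublevel n \<subseteq> X" unfolding image_sublevel by blast
  have f: "holo_map (\<Phi> ` sublevel n) ?f"
    by (rule holo_map_compose[OF holo_map_mono[OF holo_F_chart sub] holo_map_scaleR_add subset_UNIV])
  have g: "holo_map (ball 0 1) ?g"
    by (rule holo_map_compose[OF holo_map_scaleR_add holo_chart_G subset_UNIV])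
  have img: "?g ` ball 0 1 = \<Phi> ` sublevel n" using image_sublevel_eq_image_ball[of n] by simp
  have fg: "?f (?g y) = y" for y using r by (simp add: chart(4) funpow_inverse)
  have gf: "?g (?f x) = x" if "x \<in> \<Phi> ` sublevel n" for x
    using r that by (auto simp: chart(4) funpow_inverse)
  have "?f ` (\<Phi> ` sublevel n) = (\<lambda>y. ?f (?g y)) ` ball 0 1"
    unfolding img[symmetric] by (simp only: image_image)
  then have imf: "?f ` (\<Phi> ` sublevel n) = ball 0 1" unfolding fg by simp
  show ?thesis unfolding biholomorphic_def
    by (rule conjI[OF open_image_sublevel conjI[OF open_ball exI[of _ ?f, OF exI[of _ ?g]]]])
       (use f g img fg gf imf in simp)
qed

text \<open>
  If \<open>|F\<^sup>N|\<close> stays below \<open>s < radius N\<close> near \<open>p\<close>, then \<open>|F\<^sup>N\<^sup>+\<^sup>m| / radius (N + m)\<close> is at most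
  \<open>(s / radius N)\<close> to the power \<open>2\<^sup>m\<close>. By the Cauchy estimate the derivative of \<open>F\<^sup>N\<^sup>+\<^sup>m\<close> is equally small
  relative to the radius, so affine discs in the ball pull back to discs of arbitrarily large speed.
\<close>
lemma kobayashi_vanishes:
  assumes "p \<in> (\<Union>n. \<Phi> ` sublevel n)"
  shows "kobayashi (\<Union>n. \<Phi> ` sublevel n) p v = 0"
proof (rule kobayashi_eq_0)
  fix \<rho> :: real assume \<rho>: "\<rho> > 0"
  let ?f = "\<lambda>n x. (F ^^ n) (\<Psi> x)" and ?k = "real CARD('n)"
  obtain N where N: "p \<in> X" "norm (?f N p) < radius N"
    using assms image_sublevel by auto
  \<comment> \<open>A value strictly between the norm at \<open>p\<close> and
    \<open>radius N\<close>, raised to 1 because \<open>growth_iterate\<close> asks for it.\<close>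
  define s where "s = max 1 ((norm (?f N p) + radius N) / 2)"
  have s: "s \<ge> 1" "s < radius N" using N radius_gt_1[of N] by (auto simp: s_def)
  have fs: "norm (?f N p) < s" using N(2) by (simp add: s_def less_max_iff_disj)
  have "open (X \<inter> (\<lambda>x. norm (?f N x)) -` {..<s})"
    by (intro continuous_open_preimage continuous_on_norm holo_map_continuous_on holo_F_chart X open_lessThan)
  moreover have "p \<in> X \<inter> (\<lambda>x. norm (?f N x)) -` {..<s}" using N fs by simp
  ultimately obtain \<delta> where \<delta>: "\<delta> > 0" "cball p \<delta> \<subseteq> X \<inter> (\<lambda>x. norm (?f N x)) -` {..<s}"
    using open_contains_cball by blast
  let ?B = "\<lambda>m. (A * s) ^ (2 ^ m) / A"
  have bound: "norm (?f (N + m) x) \<le> ?B m" if "x \<in> cball p \<delta>" for m x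
    by (rule growth_iterate[OF s(1)]) (use that \<delta>(2) in force)
  \<comment> \<open>\<open>?B m\<close> bounds the centre of the affine disc and the remaining term
    its radius; together they must fit into the ball of radius \<open>radius (N + m)\<close>. The
    quotient of that radius by \<open>?B m\<close> is \<open>(radius N / s) ^ (2 ^ m)\<close>, which
    is unbounded.\<close>
  have "\<exists>m. ?B m * (1 + \<rho> * ?k * norm v / \<delta>) < radius (N + m)"
  proof -
    let ?c = "1 + \<rho> * ?k * norm v / \<delta>"
    have "1 < radius N / s" using s by simp
    then obtain m where m: "?c < (radius N / s) ^ m" using real_arch_pow by blast
    have "(radius N / s) ^ m \<le> (radius N / s) ^ (2 ^ m)"
      using \<open>1 < radius N / s\<close> by (intro power_increasing) (auto intro: less_imp_le less_exp)
    then have "?c < (radius N / s) ^ (2 ^ m)" using m by linarith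
    moreover have "?B m > 0" using A s by (intro divide_pos_pos zero_less_power mult_pos_pos) auto
    ultimately have "?B m * ?c < ?B m * (radius N / s) ^ (2 ^ m)" by (intro mult_strict_left_mono)
    also have "\<dots> = (A * radius N) ^ (2 ^ m) / A"
      using s A by (simp add: power_mult_distrib power_divide)
    also have "\<dots> = radius (N + m)"
      unfolding A_mult_radius by (simp add: radius_def power_add power_mult)
    finally show ?thesis by blast
  qed
  then obtain m where m: "?B m * (1 + \<rho> * ?k * norm v / \<delta>) < radius (N + m)" by blast
  define n where "n = N + m"
  define L where "L = frechet_derivative (?f n) (at p)"
  have L: "(?f n has_derivative L) (at p)" unfolding L_def
    by (rule holo_map_frechet(1)[OF holo_F_chart N(1)])
  let ?\<Theta> = "\<lambda>y. \<Phi> ((G ^^ n) y)"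
  define M where "M = frechet_derivative ?\<Theta> (at (?f n p))"
  have M: "(?\<Theta> has_derivative M) (at (?f n p))" unfolding M_def
    by (rule holo_map_frechet(1)[OF holo_chart_G UNIV_I])
  \<comment> \<open>Chain rule: near \<open>p\<close>, the map \<open>?\<Theta>\<close> undoes
    \<open>?f n\<close>. Hence a disc with velocity \<open>\<rho> *\<^sub>R L v\<close> in the ball
    is sent to one with velocity \<open>\<rho> *\<^sub>R v\<close> at \<open>p\<close>.\<close>
  have "M (L v) = v"
  proof -
    have "((\<lambda>x. x) has_derivative (\<lambda>h. M (L h))) (at p)"
      by (rule has_derivative_transform_within_open[OF has_derivative_compose[OF L M] X N(1)])
         (simp add: funpow_inverse chart(5))
    from has_derivative_unique[OF this has_derivative_ident] show ?thesis by (rule fun_cong)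
  qed
  then have Mv: "M (\<rho> *\<^sub>R L v) = \<rho> *\<^sub>R v"
    using linear_scale[OF has_derivative_linear[OF M]] by simp
  have Lv: "norm (L v) \<le> ?k * ?B m / \<delta> * norm v"
    by (rule Cauchy_estimate[OF holo_F_chart _ \<delta>(1) bound[of _ m, folded n_def] L]) (use \<delta>(2) in auto)
  let ?\<phi> = "\<lambda>t. ?\<Theta> (?f n p + t *s (\<rho> *\<^sub>R L v))"
  have "holo_disc ?\<phi>" unfolding holo_disc_def
    using holo_map_along_curve[OF holo_chart_G UNIV_I refl holo_map_frechet(1)[OF holo_chart_G UNIV_I]
        has_derivative_complex_line] by blast
  moreover have "?\<phi> ` ball 0 1 \<subseteq> \<Phi> ` sublevel n"
  proof
    fix x assume "x \<in> ?\<phi> ` ball 0 1"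
    then obtain t where t: "norm t < 1" "x = ?\<phi> t" by auto
    have "norm (?f n p + t *s (\<rho> *\<^sub>R L v)) \<le> norm (?f n p) + norm t * (\<rho> * norm (L v))"
      using norm_triangle_ineq[of "?f n p" "t *s (\<rho> *\<^sub>R L v)"] \<rho> by (simp add: norm_cscale)
    also have "\<dots> \<le> ?B m + 1 * (\<rho> * (?k * ?B m / \<delta> * norm v))"
      using bound[of p m] \<delta>(1) t(1) \<rho> Lv
      by (intro add_mono mult_mono) (auto simp: n_def)
    also have "\<dots> = ?B m * (1 + \<rho> * ?k * norm v / \<delta>)" by (simp add: distrib_left mult_ac)
    also have "\<dots> < radius n" using m by (simp add: n_def)
    finally have "(G ^^ n) (?f n p + t *s (\<rho> *\<^sub>R L v)) \<in> sublevel n"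
      by (simp add: sublevel_def funpow_inverse)
    then show "x \<in> \<Phi> ` sublevel n" using t(2) by blast
  qed
  moreover have "?\<phi> 0 = p" by (simp add: funpow_inverse chart(5) N(1))
  moreover have "(?\<phi> has_derivative (\<lambda>h. h *s (\<rho> *\<^sub>R v))) (at 0)"
    unfolding Mv[symmetric]
    by (rule holo_map_along_curve[OF holo_chart_G UNIV_I _ M has_derivative_complex_line]) simp
  ultimately show "\<exists>\<phi>. holo_disc \<phi> \<and> \<phi> ` ball 0 1 \<subseteq> (\<Union>n. \<Phi> ` sublevel n) \<and> \<phi> 0 = p \<and>
    (\<phi> has_derivative (\<lambda>h. h *s (\<rho> *\<^sub>R v))) (at 0)"
    by (intro exI[of _ ?\<phi>] conjI order_trans[OF _ UN_upper[OF UNIV_I, of _ n]])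
qed

text \<open>The upper bound is the formula for \<open>radius\<close> after taking logarithms. Two
  points separate values: along the fixed orbit of 0 the terms are \<open>ln A / 2 ^ n\<close> and
  drop below \<open>ln 2\<close>, while the escaping orbit keeps every term at least
  \<open>ln 2\<close>.\<close>

lemma bounded_psh:
  "\<exists>u. psh_on (\<Union>n. \<Phi> ` sublevel n) u \<and> (\<exists>M::real. \<forall>x\<in>(\<Union>n. \<Phi> ` sublevel n). u x \<le> ereal M) \<and>
     \<not> (\<exists>c. \<forall>x\<in>(\<Union>n. \<Phi> ` sublevel n). u x = c)"
proof -
  let ?\<Omega> = "\<Union>n. \<Phi> ` sublevel n"
  let ?v = "\<lambda>n x. log_growth A n ((F ^^ n) (\<Psi> x))"
  let ?u = "\<lambda>x. INF n. ereal (?v n x)"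
  have sub: "?\<Omega> \<subseteq> X" unfolding image_sublevel by blast
  have "psh_on ?\<Omega> ?u"
  proof (rule psh_INF_log_growth)
    show "holo_map ?\<Omega> (\<lambda>x. (F ^^ n) (\<Psi> x))" for n by (rule holo_map_mono[OF holo_F_chart sub])
    show "log_growth A (Suc n) ((F ^^ Suc n) (\<Psi> x)) \<le> ?v n x" for n x
      using log_growth_dec[of n "(F ^^ n) (\<Psi> x)"] by simp
  qed (use A in simp)
  moreover have "?u x \<le> ereal (ln (3 * A))" if x: "x \<in> ?\<Omega>" for x
  proof -
    obtain n where "x \<in> \<Phi> ` sublevel n" using x by blast
    then have n: "norm ((F ^^ n) (\<Psi> x)) < radius n" unfolding image_sublevel by simp
    have pos: "A * max 1 (norm ((F ^^ n) (\<Psi> x))) > 0" using A by (intro mult_pos_pos) auto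
    have "A * max 1 (norm ((F ^^ n) (\<Psi> x))) \<le> A * radius n"
      using n radius_gt_1[of n] A by (intro mult_left_mono) auto
    with pos have "ln (A * max 1 (norm ((F ^^ n) (\<Psi> x)))) \<le> ln (A * radius n)" by (intro ln_mono)
    also have "\<dots> = 2 ^ n * ln (3 * A)" unfolding A_mult_radius using A by (subst ln_realpow) auto
    finally have "?v n x \<le> ln (3 * A)" by (simp add: log_growth_def divide_le_eq mult.commute)
    then have "ereal (?v n x) \<le> ereal (ln (3 * A))" by simp
    then show ?thesis by (rule order_trans[OF INF_lower[OF UNIV_I]])
  qed
  moreover have "\<not> (\<exists>c. \<forall>x\<in>?\<Omega>. ?u x = c)"
  proof
    assume "\<exists>c. \<forall>x\<in>?\<Omega>. ?u x = c"
    then obtain c where c: "\<And>x. x \<in> ?\<Omega> \<Longrightarrow> ?u x = c" by blast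
    obtain z where z: "norm z < 3" "\<And>n. 2 ^ (2 ^ n) \<le> norm ((F ^^ n) z)" using escape by blast
    have "radius 0 = 3" using A by (simp add: radius_def)
    then have "z \<in> sublevel 0" "0 \<in> sublevel 0" using z(1) by (simp_all add: sublevel_def)
    then have mem: "\<Phi> z \<in> ?\<Omega>" "\<Phi> 0 \<in> ?\<Omega>" by blast+
    have "ln 2 \<le> ?v n (\<Phi> z)" for n
    proof -
      have "1 * 2 ^ (2 ^ n) \<le> A * max 1 (norm ((F ^^ n) z))" using A z(2)[of n] by (intro mult_mono) auto
      then have "ln (2 ^ (2 ^ n)) \<le> ln (A * max 1 (norm ((F ^^ n) z)))" by (intro ln_mono) auto
      then have "2 ^ n * ln 2 \<le> ln (A * max 1 (norm ((F ^^ n) z)))" by (simp add: ln_realpow)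
      then show ?thesis by (simp add: log_growth_def le_divide_eq mult.commute chart(4))
    qed
    then have "ereal (ln 2) \<le> ?u (\<Phi> z)" by (intro INF_greatest) simp
    moreover have "?u (\<Phi> 0) < ereal (ln 2)"
    proof -
      obtain n where n: "ln A / ln 2 < 2 ^ n" using real_arch_pow[of 2] by auto
      then have "ln A / 2 ^ n < ln 2" by (simp add: divide_less_eq mult.commute)
      then have "?v n (\<Phi> 0) < ln 2" by (simp add: log_growth_def chart(4) fix0)
      then have "ereal (?v n (\<Phi> 0)) < ereal (ln 2)" by simp
      then show ?thesis by (rule le_less_trans[OF INF_lower[OF UNIV_I]])
    qed
    ultimately show False using c[OF mem(1)] c[OF mem(2)] by simp
  qed
  ultimately show ?thesis by (intro exI[of _ ?u]) blast
qed

theorem short_Ck_image: "short_Ck (\<Union>n. \<Phi> ` sublevel n)"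
proof -
  have "connected (\<Union>n. \<Phi> ` sublevel n)"
  proof (rule connected_Union)
    fix S assume "S \<in> range (\<lambda>n. \<Phi> ` sublevel n)"
    then obtain n where "S = \<Phi> ` sublevel n" by blast
    then have "S = (\<lambda>y. \<Phi> ((G ^^ n) (radius n *\<^sub>R y + 0))) ` ball 0 1"
      by (simp only: image_sublevel_eq_image_ball)
    moreover have "connected ((\<lambda>y. \<Phi> ((G ^^ n) (radius n *\<^sub>R y + 0))) ` ball 0 1)"
      by (rule connected_continuous_image[OF holo_map_continuous_on
            [OF holo_map_compose[OF holo_map_scaleR_add holo_chart_G subset_UNIV]] connected_ball])
    ultimately show "connected S" by simp
  next
    have "0 \<in> sublevel n" for n using radius_gt_1[of n] by (simp add: sublevel_def fix0)
    then show "\<Inter> (range (\<lambda>n. \<Phi> ` sublevel n)) \<noteq> {}" by blast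
  qed
  moreover have "open (\<Union>n. \<Phi> ` sublevel n)" using open_image_sublevel by blast
  moreover have "\<exists>W. (\<forall>j. W j \<subseteq> W (Suc j)) \<and> (\<Union>n. \<Phi> ` sublevel n) = (\<Union>j. W j) \<and>
      (\<forall>j. biholomorphic (W j) (ball 0 1))"
    by (rule exI[of _ "\<lambda>n. \<Phi> ` sublevel n"]) (use sublevel_Suc biholomorphic_image_sublevel in blast)
  ultimately show ?thesis unfolding short_Ck_def
    using kobayashi_vanishes bounded_psh by blast
qed

end

end

section \<open>A Henon-like map\<close>

text \<open>Half the swap of coordinates \<open>i\<close> and \<open>j\<close>, with one square
  added and every other coordinate halved: contracting at 0, yet with an orbit that squares at each
  step.\<close>

definition henon :: "'n \<Rightarrow> 'n \<Rightarrow> complex^'n \<Rightarrow> complex^'n" where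
  "henon i j z = (\<chi> l. if l = i then z $ j / 2 else if l = j then z $ i / 2 + (z $ j)\<^sup>2 else z $ l / 2)"

definition henon_inverse :: "'n \<Rightarrow> 'n \<Rightarrow> complex^'n \<Rightarrow> complex^'n" where
  "henon_inverse i j w = (\<chi> l. if l = i then 2 * w $ j - 8 * (w $ i)\<^sup>2 else if l = j then 2 * w $ i else 2 * w $ l)"

lemma henon_nth:
  "henon i j z $ l = (if l = i then z $ j / 2 else if l = j then z $ i / 2 + (z $ j)\<^sup>2 else z $ l / 2)"
  by (simp add: henon_def)

lemma henon_inverse_nth:
  "henon_inverse i j w $ l = (if l = i then 2 * w $ j - 8 * (w $ i)\<^sup>2 else if l = j then 2 * w $ i else 2 * w $ l)"
  by (simp add: henon_inverse_def)

lemma henon_inverse: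
  assumes "i \<noteq> j"
  shows "henon_inverse i j (henon i j z) = z" "henon i j (henon_inverse i j z) = z"
  using assms by (auto simp: vec_eq_iff henon_nth henon_inverse_nth power2_eq_square field_simps)

lemma entire_monomial_combinations:
  "entire (\<lambda>x. a * x $ l)" "entire (\<lambda>x. a * x $ l + b * (x $ m)\<^sup>2)"
  by (auto simp: power2_eq_square intro!: entire_add entire_mult entire_const entire_nth)

lemma holo_map_henon: "holo_map UNIV (henon i j)" "holo_map UNIV (henon_inverse i j)"
proof -
  show "holo_map UNIV (henon i j)"
  proof (rule holo_map_componentwise)
    show "entire (\<lambda>x. henon i j x $ l)" for l
      using entire_monomial_combinations(1)[of "1/2"] entire_monomial_combinations(2)[of "1/2" i 1 j]
      by (cases "l = i"; cases "l = j") (simp_all add: henon_nth)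
  qed
  show "holo_map UNIV (henon_inverse i j)"
  proof (rule holo_map_componentwise)
    show "entire (\<lambda>x. henon_inverse i j x $ l)" for l
      using entire_monomial_combinations(1)[of 2] entire_monomial_combinations(2)[of 2 j "-8" i]
      by (cases "l = i"; cases "l = j") (simp_all add: henon_inverse_nth)
  qed
qed

lemma henon_derivative_0:
  "(henon i j has_derivative (\<lambda>h. \<chi> l. if l = i then h $ j / 2 else if l = j then h $ i / 2 else h $ l / 2)) (at 0)"
proof (rule has_derivative_vec_componentwise)
  fix l
  have nth: "((\<lambda>x::complex^'a. x $ m) has_derivative (\<lambda>h. h $ m)) (at 0)" for m
    by (rule bounded_linear.has_derivative[OF bounded_linear_vec_nth has_derivative_ident])
  have half: "((\<lambda>x::complex^'a. x $ m / 2) has_derivative (\<lambda>h. h $ m / 2)) (at 0)" for m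
    using has_derivative_mult_right[OF nth, of "1/2"] by simp
  have "((\<lambda>x::complex^'a. x $ i / 2 + x $ j * x $ j) has_derivative (\<lambda>h. h $ i / 2 + (0 $ j * h $ j + h $ j * 0 $ j))) (at 0)"
    by (intro has_derivative_add half has_derivative_mult nth)
  with half show "((\<lambda>x. henon i j x $ l) has_derivative
     (\<lambda>h. (\<chi> l. if l = i then h $ j / 2 else if l = j then h $ i / 2 else h $ l / 2) $ l)) (at 0)"
    by (cases "l = i"; cases "l = j") (simp_all add: henon_nth power2_eq_square)
qed

text \<open>The swap is an involution, so two steps have derivative one quarter of the identity, as
  the linearisation requires.\<close>

lemma henon_square_attracting:
  fixes i j :: "'n::finite"
  assumes "i \<noteq> j"
  shows "attracting_automorphism (\<lambda>z. henon i j (henon i j z)) (\<lambda>z. henon_inverse i j (henon_inverse i j z)) (1/4)"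
proof
  let ?D = "\<lambda>h::complex^'n. \<chi> l. if l = i then h $ j / 2 else if l = j then h $ i / 2 else h $ l / 2"
  show "holo_map UNIV (\<lambda>z. henon i j (henon i j z))" "holo_map UNIV (\<lambda>z. henon_inverse i j (henon_inverse i j z))"
    by (rule holo_map_compose[OF holo_map_henon(1) holo_map_henon(1) subset_UNIV]
        holo_map_compose[OF holo_map_henon(2) holo_map_henon(2) subset_UNIV])+
  have h0: "henon i j 0 = 0" by (simp add: vec_eq_iff henon_nth)
  then show "henon i j (henon i j 0) = 0" by simp
  have "((\<lambda>z. henon i j (henon i j z)) has_derivative (\<lambda>h. ?D (?D h))) (at 0)"
    by (rule has_derivative_compose[OF henon_derivative_0]) (use henon_derivative_0[of i j] h0 in simp)
  moreover have "?D (?D h) = (1/4) *\<^sub>R h" for h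
    unfolding vec_eq_iff vector_scaleR_component using assms by (simp add: scaleR_conv_of_real)
  ultimately show "((\<lambda>z. henon i j (henon i j z)) has_derivative (\<lambda>h. (1/4) *\<^sub>R h)) (at 0)" by simp
qed (use henon_inverse[OF assms] in auto)

text \<open>Along the orbit of \<open>axis j 2\<close> both coordinates stay real and nonnegative,
  so nothing cancels and coordinate \<open>j\<close> is at least squared.\<close>

lemma henon_escape:
  assumes "i \<noteq> j"
  shows "\<exists>x y. (henon i j ^^ n) (axis j 2) $ j = of_real x \<and> (henon i j ^^ n) (axis j 2) $ i = of_real y \<and>
    2 ^ (2 ^ n) \<le> x \<and> 0 \<le> y"
proof (induction n)
  case 0
  show ?case by (rule exI[of _ 2], rule exI[of _ 0]) (use assms in \<open>simp add: axis_def\<close>)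
next
  case (Suc n)
  then obtain x y where xy: "(henon i j ^^ n) (axis j 2) $ j = of_real x" "(henon i j ^^ n) (axis j 2) $ i = of_real y"
    "2 ^ (2 ^ n) \<le> x" "0 \<le> y" by blast
  have "(2 ^ (2 ^ n))\<^sup>2 \<le> x\<^sup>2" using xy(3) by (intro power_mono) auto
  then have "2 ^ (2 ^ Suc n) \<le> y / 2 + x\<^sup>2" using xy(4) by (simp add: power_mult[symmetric] mult.commute)
  moreover have "0 \<le> x / 2" using order_trans[OF _ xy(3), of 0] by simp
  ultimately show ?case
    using assms xy(1,2) by (intro exI[of _ "y / 2 + x\<^sup>2"] exI[of _ "x / 2"]) (simp add: henon_nth)
qed

text \<open>Constant: a component has at most two terms, each bounded by the square of
  \<open>max 1 (norm z)\<close>, and the norm is at most the sum of the \<open>CARD('n)\<close>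
  components.\<close>

lemma henon_quadratic_growth:
  fixes i j :: "'n::finite"
  assumes "i \<noteq> j"
  shows "quadratic_growth_automorphism (henon i j) (henon_inverse i j) (2 * real CARD('n))"
proof
  let ?k = "real CARD('n)"
  have "1 \<le> CARD('n)" by (simp add: Suc_leI)
  then show "1 \<le> 2 * ?k" by linarith
  show "norm (henon i j z) \<le> 2 * ?k * (max 1 (norm z))\<^sup>2" for z
  proof -
    let ?m = "max 1 (norm z)"
    have comp: "norm (z $ l) \<le> ?m" for l
      using Finite_Cartesian_Product.norm_nth_le[of z l] by linarith
    have m2: "?m \<le> ?m\<^sup>2" by (rule self_le_power) auto
    have half: "norm (z $ l / 2) \<le> ?m\<^sup>2" for l
    proof -
      have "norm (z $ l / 2) \<le> norm (z $ l)" by (simp add: norm_divide)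
      then show ?thesis using comp[of l] m2 by linarith
    qed
    have "norm (henon i j z $ l) \<le> 2 * ?m\<^sup>2" for l
    proof -
      have "norm (z $ i / 2 + (z $ j)\<^sup>2) \<le> norm (z $ i / 2) + (norm (z $ j))\<^sup>2"
        by (metis norm_power norm_triangle_ineq)
      also have "\<dots> \<le> ?m\<^sup>2 + ?m\<^sup>2" by (intro add_mono half power_mono comp) simp
      finally have "norm (z $ i / 2 + (z $ j)\<^sup>2) \<le> 2 * ?m\<^sup>2" by simp
      moreover have "norm (z $ l / 2) \<le> 2 * ?m\<^sup>2" for l using half[of l] by (smt (verit) zero_le_power2)
      ultimately show ?thesis by (simp only: henon_nth split: if_split) blast
    qed
    then have "(\<Sum>l\<in>UNIV. norm (henon i j z $ l)) \<le> ?k * (2 * ?m\<^sup>2)"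
      by (rule sum_bounded_above)
    moreover have "norm (henon i j z) \<le> (\<Sum>l\<in>UNIV. norm (henon i j z $ l))"
      unfolding norm_vec_def by (rule L2_set_le_sum) simp
    ultimately show ?thesis by simp
  qed
  have "2 ^ (2 ^ n) \<le> norm ((henon i j ^^ n) (axis j 2))" for n
  proof -
    obtain x where x: "(henon i j ^^ n) (axis j 2) $ j = of_real x" "2 ^ (2 ^ n) \<le> x"
      using henon_escape[OF assms, of n] by blast
    have "x \<le> norm ((henon i j ^^ n) (axis j 2) $ j)" using x(1) by simp
    also have "\<dots> \<le> norm ((henon i j ^^ n) (axis j 2))" by (rule Finite_Cartesian_Product.norm_nth_le)
    finally show ?thesis using x(2) by linarith
  qed
  moreover have "norm (axis j 2 :: complex^'n) < 3" 
  proof -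
    have "norm (axis j 2 :: complex^'n) \<le> (\<Sum>l\<in>UNIV. norm (axis j 2 $ l :: complex))"
      unfolding norm_vec_def by (rule L2_set_le_sum) simp
    also have "\<dots> = 2" by (simp add: axis_def if_distrib cong: if_cong)
    finally show ?thesis by simp
  qed
  ultimately show "\<exists>z. norm z < 3 \<and> (\<forall>n. 2 ^ (2 ^ n) \<le> norm ((henon i j ^^ n) z))" by blast
qed (use henon_inverse[OF assms] holo_map_henon in \<open>auto simp: vec_eq_iff henon_nth\<close>)

section \<open>Assembly in the complement of the variety\<close>

lemma biholomorphism_translate_image:
  assumes "biholomorphism A UNIV \<psi> \<Phi>"
  shows "biholomorphism UNIV ((\<lambda>z. q + z) ` A) (\<lambda>z. q + \<Phi> z) (\<lambda>x. \<psi> (x - q))"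
proof -
  have \<Phi>: "holo_map UNIV \<Phi>" and \<psi>: "holo_map A \<psi>" and im: "\<Phi> ` UNIV = A"
    and inv: "\<And>x. x \<in> A \<Longrightarrow> \<Phi> (\<psi> x) = x" "\<And>y. \<psi> (\<Phi> y) = y"
    using assms unfolding biholomorphism_def by auto
  have "holo_map UNIV (\<lambda>z. 1 *\<^sub>R \<Phi> z + q)"
    by (rule holo_map_compose[OF \<Phi> holo_map_scaleR_add subset_UNIV])
  then have h1: "holo_map UNIV (\<lambda>z. q + \<Phi> z)" by (simp add: add.commute)
  have "holo_map ((\<lambda>z. q + z) ` A) (\<lambda>x. \<psi> (1 *\<^sub>R x + (- q)))"
    by (rule holo_map_compose[OF holo_map_scaleR_add \<psi>]) auto
  then have h2: "holo_map ((\<lambda>z. q + z) ` A) (\<lambda>x. \<psi> (x - q))" by simp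
  have "(\<lambda>z. q + \<Phi> z) ` UNIV = (\<lambda>z. q + z) ` A" using im by (metis image_image)
  moreover have "(\<lambda>x. \<psi> (x - q)) ` (\<lambda>z. q + z) ` A = UNIV"
    using im inv(2) by (force simp: image_image)
  ultimately show ?thesis unfolding biholomorphism_def using h1 h2 inv by auto
qed

theorem theorem1p4:
  fixes V :: "(complex^'n) set"
  assumes "CARD('n) \<ge> 3"
    and "algebraic_set V"
    and "has_alg_dim V (CARD('n) - 2)"
  shows "\<exists>\<Omega> D. short_Ck \<Omega> \<and> fatou_bieberbach D \<and> D \<subseteq> \<Omega> \<and> \<Omega> \<subseteq> UNIV - V"
proof -
  obtain q F G where att: "attracting_automorphism F G (1/2)" and q: "q \<notin> V"
    and fixV: "\<And>z. q + z \<in> V \<Longrightarrow> F z = z"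
  proof (rule automorphism_fixing_variety[OF _ assms(3)])
    show "2 \<le> CARD('n)" using assms(1) by simp
  qed (rule that)
  interpret B: attracting_automorphism F G "1/2" by (rule att)
  define X where "X = (\<lambda>z. q + z) ` B.basin"
  have "open X" unfolding X_def using B.basin_biholomorphic(1) by (rule open_translation)
  obtain \<psi> \<phi> where "biholomorphism B.basin UNIV \<psi> \<phi>" using B.basin_biholomorphic(2) by blast
  then obtain \<Phi> \<Psi> where bih: "biholomorphism UNIV X \<Phi> \<Psi>"
    unfolding X_def using biholomorphism_translate_image by blast
  have XV: "X \<inter> V = {}"
  proof -
    \<comment> \<open>A point of the translated variety is fixed by \<open>F\<close>, so its orbit
      converges to 0 only if it is 0 itself; that would put \<open>q\<close> in
      \<open>V\<close>.\<close>
    have False if "z \<in> B.basin" "q + z \<in> V" for z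
    proof -
      have "(F ^^ n) z = z" for n by (induction n) (auto simp: fixV[OF that(2)])
      then have "z = 0" using that(1) by (simp add: B.basin_def LIMSEQ_const_iff)
      then show False using that(2) q by simp
    qed
    then show ?thesis unfolding X_def by blast
  qed
  have "\<not> (\<forall>i j :: 'n. i = j)"
  proof
    assume "\<forall>i j :: 'n. i = j"
    then have "CARD('n) \<le> 1" using card_le_Suc0_iff_eq[of "UNIV :: 'n set"] by simp
    then show False using assms(1) by simp
  qed
  then obtain i j :: 'n where ij: "i \<noteq> j" by blast
  interpret H: quadratic_growth_automorphism "henon i j" "henon_inverse i j" "2 * real CARD('n)"
    by (rule henon_quadratic_growth[OF ij])
  interpret C: attracting_automorphism "\<lambda>z. henon i j (henon i j z)"
    "\<lambda>z. henon_inverse i j (henon_inverse i j z)" "1/4"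
    by (rule henon_square_attracting[OF ij])
  define \<Omega> where "\<Omega> = (\<Union>n. \<Phi> ` H.sublevel n)"
  define D where "D = \<Phi> ` C.basin"
  note chart = H.chart[OF bih \<open>open X\<close>]
  have short: "short_Ck \<Omega>" unfolding \<Omega>_def by (rule H.short_Ck_image[OF bih \<open>open X\<close>])
  have "\<Omega> \<subseteq> UNIV - V" unfolding \<Omega>_def using chart(3) XV by blast
  have funpow2: "((\<lambda>z. henon i j (henon i j z)) ^^ n) z = (henon i j ^^ (2 * n)) z" for n z
    by (induction n) simp_all
  have basin_norm: "\<exists>n. norm ((henon i j ^^ (2 * n)) z) < 1" if "z \<in> C.basin" for z
  proof -
    have "(\<lambda>n. (henon i j ^^ (2 * n)) z) \<longlonglongrightarrow> 0" using that unfolding C.basin_def funpow2 by simp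
    then have "\<exists>N. \<forall>n\<ge>N. norm ((henon i j ^^ (2 * n)) z - 0) < 1" by (rule LIMSEQ_D) simp
    then show ?thesis by auto
  qed
  have "D \<subseteq> \<Omega>"
  proof -
    \<comment> \<open>Basin orbits come below norm 1 at an even time, and \<open>H.radius\<close>
      exceeds 1 at every index.\<close>
    have "\<exists>n. z \<in> H.sublevel n" if z: "z \<in> C.basin" for z
    proof -
      obtain n where "norm ((henon i j ^^ (2 * n)) z) < 1" using basin_norm[OF z] by blast
      then have "z \<in> H.sublevel (2 * n)" using H.radius_gt_1[of "2 * n"] by (simp add: H.sublevel_def)
      then show ?thesis by blast
    qed
    then show ?thesis unfolding D_def \<Omega>_def by blast
  qed
  moreover have "fatou_bieberbach D"
  proof -
    have oD: "open D"
    proof -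
      have "open (X \<inter> \<Psi> -` C.basin)"
        by (rule continuous_open_preimage[OF holo_map_continuous_on[OF chart(2)] \<open>open X\<close> C.basin_biholomorphic(1)])
      moreover have "X \<inter> \<Psi> -` C.basin = D"
      proof (intro equalityI subsetI)
        fix x assume "x \<in> X \<inter> \<Psi> -` C.basin"
        then have "x = \<Phi> (\<Psi> x)" "\<Psi> x \<in> C.basin" by (simp_all add: chart(5))
        then show "x \<in> D" unfolding D_def by (rule image_eqI)
      qed (auto simp: D_def chart(3,4))
      ultimately show ?thesis by simp
    qed
    obtain f g where "biholomorphism C.basin UNIV f g" using C.basin_biholomorphic(2) by blast
    then have f: "holo_map C.basin f" "holo_map UNIV g" "f ` C.basin = UNIV" "g ` UNIV = C.basin"
      "\<And>x. x \<in> C.basin \<Longrightarrow> g (f x) = x" "\<And>y. f (g y) = y" unfolding biholomorphism_def by auto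
    have holf: "holo_map D (\<lambda>x. f (\<Psi> x))"
      by (rule holo_map_compose[OF holo_map_mono[OF chart(2)] f(1)]) (use chart(3,4) in \<open>auto simp: D_def\<close>)
    have holg: "holo_map UNIV (\<lambda>y. \<Phi> (g y))" by (rule holo_map_compose[OF f(2) chart(1) subset_UNIV])
    have gD: "(\<lambda>y. \<Phi> (g y)) ` UNIV = D" unfolding D_def f(4)[symmetric] by (simp add: image_image)
    have fD: "(\<lambda>x. f (\<Psi> x)) ` D = UNIV" unfolding D_def using f(3) by (simp add: image_image chart(4))
    have "\<forall>x\<in>D. \<Phi> (g (f (\<Psi> x))) = x" unfolding D_def by (auto simp: chart(4) f(5))
    moreover have "\<forall>y\<in>UNIV. f (\<Psi> (\<Phi> (g y))) = y" by (simp add: chart(4) f(6))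
    ultimately have "biholomorphic D UNIV" unfolding biholomorphic_def
      using oD open_UNIV holf holg gD fD by blast
    moreover have "connected D" unfolding gD[symmetric]
      by (rule connected_continuous_image[OF holo_map_continuous_on[OF holg] connected_UNIV])
    \<comment> \<open>The image under \<open>\<Phi>\<close> of the escaping point lies outside
      \<open>D\<close>, as its orbit never comes below norm 1.\<close>
    moreover have "D \<noteq> UNIV"
    proof
      assume "D = UNIV"
      obtain z where z: "\<And>n. 2 ^ (2 ^ n) \<le> norm ((henon i j ^^ n) z)" using H.escape by blast
      have "\<Phi> z \<in> D" using \<open>D = UNIV\<close> by simp
      then have "z \<in> C.basin" unfolding D_def using chart(4) by (metis imageE)
      then obtain n where "norm ((henon i j ^^ (2 * n)) z) < 1" using basin_norm by blast
      moreover have "(1::real) \<le> 2 ^ (2 ^ (2 * n))" by simp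
      ultimately show False using z[of "2 * n"] by linarith
    qed
    ultimately show ?thesis unfolding fatou_bieberbach_def by blast
  qed
  ultimately show ?thesis using short \<open>\<Omega> \<subseteq> UNIV - V\<close> by blast
qed

end
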